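(* There is a polynomial-time algorithm which, given a solvable instance of Stable Roommates with Incomplete lists in which every preference list has length at most $3$, outputs a stable matching $M'$ with $c(M')\le \frac{9}{7}\,c(M_{\mathrm{egal}})$, where $M_{\mathrm{egal}}$ is an egalitarian stable matching of the instance.
   Context: An instance of the Stable Roommates problem with Incomplete lists (SRI) consists of a graph $G=(A,E)$ whose vertices are agents, and for each agent a strict linear order (its preference list) on its neighbours in $G$. For a matching $M$, an edge $a_ia_j\notin M$ blocks $M$ if each of $a_i,a_j$ is unmatched or prefers the other to its partner in $M$; $M$ is stable if no edge blocks it; the instance is solvable if a stable matching exists. $\mathrm{rank}(a_i,a_j)$ is $1$ plus the number of agents $a_i$ prefers to $a_j$. The cost of a stable matching $M$ is $c(M)=\sum_{a_i \text{ matched in } M}\mathrm{rank}(a_i,M(a_i))$, and an egalitarian stable matching is a stable matching minimising $c(M)$. *)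

theory Defs
  imports
    "HOL-Computational_Algebra.Polynomial"
    "HOL-Library.Log_Nat"
begin

section \<open>Stable Roommates with Incomplete lists\<close>

text \<open>The strict linear order of an agent on its neighbours is given as a duplicate-free list,
  most preferred neighbour first.\<close>

record 'a sri =
  agents :: "'a set"
  edges :: "'a set set"
  pref_list :: "'a \<Rightarrow> 'a list"

definition sri_instance :: "'a sri \<Rightarrow> bool" where
  "sri_instance I \<longleftrightarrow>
     finite (agents I) \<and>
     edges I \<subseteq> {{a, b} | a b. a \<in> agents I \<and> b \<in> agents I \<and> a \<noteq> b} \<and>
     (\<forall>a \<in> agents I. distinct (pref_list I a) \<and> set (pref_list I a) = {b. {a, b} \<in> edges I})"

definition prefers :: "'a sri \<Rightarrow> 'a \<Rightarrow> 'a \<Rightarrow> 'a \<Rightarrow> bool" where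
  "prefers I a b c \<longleftrightarrow>
     (\<exists>i j. i < j \<and> j < length (pref_list I a) \<and> pref_list I a ! i = b \<and> pref_list I a ! j = c)"

definition rank :: "'a sri \<Rightarrow> 'a \<Rightarrow> 'a \<Rightarrow> nat" where
  "rank I a b = 1 + card {c. prefers I a c b}"

definition matching :: "'a sri \<Rightarrow> 'a set set \<Rightarrow> bool" where
  "matching I M \<longleftrightarrow> M \<subseteq> edges I \<and> pairwise disjnt M"

definition matched :: "'a set set \<Rightarrow> 'a \<Rightarrow> bool" where
  "matched M a \<longleftrightarrow> (\<exists>e \<in> M. a \<in> e)"

definition partner :: "'a set set \<Rightarrow> 'a \<Rightarrow> 'a" where
  "partner M a = (THE b. {a, b} \<in> M)"

text \<open>The quantifier ranges over both orientations of the edge, hence over both endpoints.\<close>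

definition blocks :: "'a sri \<Rightarrow> 'a set set \<Rightarrow> 'a set \<Rightarrow> bool" where
  "blocks I M e \<longleftrightarrow> e \<in> edges I \<and> e \<notin> M \<and>
     (\<forall>a b. e = {a, b} \<longrightarrow> \<not> matched M a \<or> prefers I a b (partner M a))"

definition stable_matching :: "'a sri \<Rightarrow> 'a set set \<Rightarrow> bool" where
  "stable_matching I M \<longleftrightarrow> matching I M \<and> (\<nexists>e. blocks I M e)"

definition solvable :: "'a sri \<Rightarrow> bool" where
  "solvable I \<longleftrightarrow> (\<exists>M. stable_matching I M)"

definition cost :: "'a sri \<Rightarrow> 'a set set \<Rightarrow> nat" where
  "cost I M = (\<Sum>a | a \<in> agents I \<and> matched M a. rank I a (partner M a))"

definition egalitarian :: "'a sri \<Rightarrow> 'a set set \<Rightarrow> bool" where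
  "egalitarian I M \<longleftrightarrow> is_arg_min (cost I) (stable_matching I) M"

lemma solvable_imp_egalitarian: "solvable I \<Longrightarrow> \<exists>M. egalitarian I M"
  unfolding solvable_def egalitarian_def is_arg_min_linorder
  by (metis ex_has_least_nat)


section \<open>Polynomial-time algorithms\<close>

text \<open>
  The machine model is a random access machine on natural numbers, with structured control flow.
  It has scalar registers and sparse arrays with indirect addressing; both are named by natural
  numbers, and a program mentions only finitely many names. The arithmetic operations are addition
  and truncated subtraction, and every assignment and every test takes one unit of time. There is
  no multiplication, so a step can increase the largest stored number at most by a constant factor
  and a constant summand (both depending on the program only). Polynomial time on this machine
  therefore coincides with polynomial time on Turing machines.
\<close>

datatype aexp =
    Const nat
  | Reg nat
  | Cell nat aexp
  | Add aexp aexp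
  | Sub aexp aexp

datatype bexp =
    Less aexp aexp
  | Equal aexp aexp
  | Neg bexp
  | Conj bexp bexp

datatype com =
    Skip
  | Assign nat aexp
  | Store nat aexp aexp
  | Seq com com
  | Cond bexp com com
  | While bexp com

record state =
  regs :: "nat \<Rightarrow> nat"
  arrays :: "nat \<Rightarrow> nat \<Rightarrow> nat"

primrec aval :: "aexp \<Rightarrow> state \<Rightarrow> nat" where
  "aval (Const k) s = k"
| "aval (Reg x) s = regs s x"
| "aval (Cell r a) s = arrays s r (aval a s)"
| "aval (Add a b) s = aval a s + aval b s"
| "aval (Sub a b) s = aval a s - aval b s"

primrec bval :: "bexp \<Rightarrow> state \<Rightarrow> bool" where
  "bval (Less a b) s \<longleftrightarrow> aval a s < aval b s"
| "bval (Equal a b) s \<longleftrightarrow> aval a s = aval b s"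
| "bval (Neg b) s \<longleftrightarrow> \<not> bval b s"
| "bval (Conj b c) s \<longleftrightarrow> bval b s \<and> bval c s"

definition set_reg :: "nat \<Rightarrow> nat \<Rightarrow> state \<Rightarrow> state" where
  "set_reg x v s = s\<lparr>regs := (regs s)(x := v)\<rparr>"

definition set_cell :: "nat \<Rightarrow> nat \<Rightarrow> nat \<Rightarrow> state \<Rightarrow> state" where
  "set_cell r i v s = s\<lparr>arrays := (arrays s)(r := (arrays s r)(i := v))\<rparr>"

text \<open>\<open>exec c s t s'\<close>: started in \<open>s\<close>, the program \<open>c\<close> halts in \<open>s'\<close> after \<open>t\<close> steps.\<close>

inductive exec :: "com \<Rightarrow> state \<Rightarrow> nat \<Rightarrow> state \<Rightarrow> bool" where
  Skip: "exec Skip s 1 s"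
| Assign: "exec (Assign x a) s 1 (set_reg x (aval a s) s)"
| Store: "exec (Store r i a) s 1 (set_cell r (aval i s) (aval a s) s)"
| Seq: "exec c s t s' \<Longrightarrow> exec d s' u s'' \<Longrightarrow> exec (Seq c d) s (t + u) s''"
| CondTrue: "bval b s \<Longrightarrow> exec c s t s' \<Longrightarrow> exec (Cond b c d) s (1 + t) s'"
| CondFalse: "\<not> bval b s \<Longrightarrow> exec d s t s' \<Longrightarrow> exec (Cond b c d) s (1 + t) s'"
| WhileFalse: "\<not> bval b s \<Longrightarrow> exec (While b c) s 1 s"
| WhileTrue: "bval b s \<Longrightarrow> exec c s t s' \<Longrightarrow> exec (While b c) s' u s'' \<Longrightarrow>
    exec (While b c) s (1 + t + u) s''"

inductive_cases SkipE: "exec Skip s t s'"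
inductive_cases AssignE: "exec (Assign x a) s t s'"
inductive_cases StoreE: "exec (Store r i a) s t s'"
inductive_cases SeqE: "exec (Seq c d) s t s'"
inductive_cases CondE: "exec (Cond b c d) s t s'"
inductive_cases WhileE: "exec (While b c) s t s'"

lemma exec_deterministic:
  "exec c s t s' \<Longrightarrow> exec c s u s'' \<Longrightarrow> u = t \<and> s'' = s'"
proof (induction arbitrary: u s'' rule: exec.induct)
  case (Seq c s t s' d v r)
  from Seq.prems obtain t1 s1 v1 where
    "exec c s t1 s1" "exec d s1 v1 s''" "u = t1 + v1"
    by (rule SeqE)
  with Seq.IH(1)[of t1 s1] Seq.IH(2)[of v1 s''] show ?case by simp
next
  case (CondTrue b s c t s' d)
  from CondTrue.prems CondTrue.hyps obtain t1 where "exec c s t1 s''" "u = 1 + t1"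
    by (auto elim: CondE)
  with CondTrue.IH[of t1 s''] show ?case by simp
next
  case (CondFalse b s d t s' c)
  from CondFalse.prems CondFalse.hyps obtain t1 where "exec d s t1 s''" "u = 1 + t1"
    by (auto elim: CondE)
  with CondFalse.IH[of t1 s''] show ?case by simp
next
  case (WhileFalse b s c)
  from WhileFalse.prems show ?case
    by (rule WhileE) (simp_all add: WhileFalse.hyps)
next
  case (WhileTrue b s c t s' v r)
  from WhileTrue.prems obtain t1 s1 v1 where
    "exec c s t1 s1" "exec (While b c) s1 v1 s''" "u = 1 + t1 + v1"
    by (rule WhileE) (simp_all add: WhileTrue.hyps)
  with WhileTrue.IH(1)[of t1 s1] WhileTrue.IH(2)[of v1 s''] show ?case by simp
qed (auto elim: SkipE AssignE StoreE)

text \<open>The input is a list of numbers, placed in array 0 with its length in register 0; all other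
  registers and cells are initially 0. The output is read from array 1, its length from
  register 1.\<close>

definition initial_state :: "nat list \<Rightarrow> state" where
  "initial_state xs =
     \<lparr>regs = (\<lambda>_. 0)(0 := length xs),
      arrays = (\<lambda>_ _. 0)(0 := (\<lambda>i. if i < length xs then xs ! i else 0))\<rparr>"

definition result :: "state \<Rightarrow> nat list" where
  "result s = map (arrays s 1) [0..<regs s 1]"

definition computes :: "com \<Rightarrow> nat list \<Rightarrow> nat \<Rightarrow> nat list \<Rightarrow> bool" where
  "computes c xs t ys \<longleftrightarrow> (\<exists>s. exec c (initial_state xs) t s \<and> result s = ys)"

text \<open>Total number of binary digits, plus one separator for each number.\<close>

definition bit_size :: "nat list \<Rightarrow> nat" where
  "bit_size xs = (\<Sum>x\<leftarrow>xs. Suc (floorlog 2 x))"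


section \<open>Encoding of instances and matchings\<close>

text \<open>As inputs of an algorithm, instances have their agents numbered \<open>0, \<dots>, n - 1\<close>. The encoding
  of an instance is \<open>n\<close> followed by the preference lists, each preceded by its length; the edges
  are determined by the lists. A matching is the list of the partners, shifted by one so that 0 can
  stand for an unmatched agent.\<close>

definition numbered :: "nat sri \<Rightarrow> bool" where
  "numbered I \<longleftrightarrow> agents I = {0..<card (agents I)}"

definition encode_instance :: "nat sri \<Rightarrow> nat list" where
  "encode_instance I =
     card (agents I) #
     concat (map (\<lambda>a. length (pref_list I a) # pref_list I a) [0..<card (agents I)])"

definition encode_matching :: "nat sri \<Rightarrow> nat set set \<Rightarrow> nat list" where
  "encode_matching I M =
     map (\<lambda>a. if matched M a then Suc (partner M a) else 0) [0..<card (agents I)]"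

end

theory Submission
  imports Defs
begin

text \<open>
  A table is given by an upper bound \<open>u a\<close> for the rank of the partner of every agent \<open>a\<close>; an
  edge belongs to it if both ends respect their bounds. Call a table closed if \<open>a\<close> is the last entry
  of \<open>b\<close> whenever \<open>b\<close> is the first entry of \<open>a\<close>. Starting from the full table, proposals lead to
  a closed table \<open>v\<close> that contains all stable matchings. A closed subtable without new empty
  lists always contains a stable matching (lemma \<open>clamp\<close>).

  As many agents get their first entry as get their last one. Hence the cost of a stable matching is
  a constant \<open>K\<close> plus the number \<open>w\<close> of those agents who get their first entry among the agents
  whose list in \<open>v\<close> consists of two entries of consecutive ranks. Moreover \<open>w \<le> K / 2\<close>,
  so that \<open>w' \<le> 3 w\<close> suffices for \<open>7 (K + w') \<le> 9 (K + w)\<close>.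

  A stable matching with \<open>w' \<le> 2 w\<close> is found by a local ratio argument in the style of Gusfield and
  Pitt: for an agent with several entries left, either the first or the last one is
  deleted and the table closed again. Every stable matching gives all the agents that are newly
  forced to their first entry in one of the two branches this entry. The algorithm takes the cheaper
  branch, and the cost is charged to agents that have not been charged before.
\<close>

section \<open>Tables and stable matchings\<close>

text \<open>Closedness makes "\<open>b\<close> is the first entry of \<open>a\<close>" equivalent to
  "\<open>a\<close> is the last entry of \<open>b\<close>", so a partner of somebody who gets a
  first entry gets a last one. This is why both kinds are equally frequent. The obstacle to a local
  ratio argument is that the stable matching used for comparison need not lie in the current table:
  earlier branches may have cut it off. Its projection into the table decides which branch it
  follows, and the point is that an agent with two consecutive ranks whose bound drops on that
  branch already had its first entry in the unprojected matching. Only the cheaper branch is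
  executed, while the optimum may follow the other one. If \<open>c\<close> agents are forced on the
  cheaper branch, up to \<open>c\<close> further agents forced on the other branch are charged as
  well. At most \<open>2 c\<close> agents are charged, and on either branch the optimum gives at
  least \<open>c\<close> of them their first entry; this is the origin of the factor 2. The ratio
  9/7 is the extreme case \<open>w' = 3 w\<close>, \<open>K = 6 w\<close>, namely
  \<open>(6 + 3) / (6 + 1)\<close>.\<close>

locale roommates =
  fixes n :: nat and E :: "nat \<Rightarrow> nat \<Rightarrow> bool" and rk :: "nat \<Rightarrow> nat \<Rightarrow> nat"
  assumes E_sym: "E a b \<Longrightarrow> E b a"
    and E_less: "E a b \<Longrightarrow> a < n"
    and rk_inj: "E a b \<Longrightarrow> E a c \<Longrightarrow> rk a b = rk a c \<Longrightarrow> b = c"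
    and rk_pos: "E a b \<Longrightarrow> 0 < rk a b"
    and rk_le: "E a b \<Longrightarrow> rk a b \<le> 3"
begin

definition entry :: "(nat \<Rightarrow> nat) \<Rightarrow> nat \<Rightarrow> nat \<Rightarrow> bool" where
  "entry u a b \<longleftrightarrow> E a b \<and> rk a b \<le> u a \<and> rk b a \<le> u b"

definition supp :: "(nat \<Rightarrow> nat) \<Rightarrow> nat set" where
  "supp u = {a. \<exists>b. entry u a b}"

definition first :: "(nat \<Rightarrow> nat) \<Rightarrow> nat \<Rightarrow> nat \<Rightarrow> bool" where
  "first u a b \<longleftrightarrow> entry u a b \<and> (\<forall>c. entry u a c \<longrightarrow> rk a b \<le> rk a c)"

definition head :: "(nat \<Rightarrow> nat) \<Rightarrow> nat \<Rightarrow> nat" where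
  "head u a = (THE b. first u a b)"

definition closed :: "(nat \<Rightarrow> nat) \<Rightarrow> bool" where
  "closed u \<longleftrightarrow> (\<forall>a b. first u a b \<longrightarrow> u b \<le> rk b a)"

definition satisfied :: "(nat \<Rightarrow> nat option) \<Rightarrow> nat \<Rightarrow> nat \<Rightarrow> bool" where
  "satisfied p a b \<longleftrightarrow> (\<exists>c. p a = Some c \<and> rk a c \<le> rk a b)"

definition stable :: "(nat \<Rightarrow> nat option) \<Rightarrow> bool" where
  "stable p \<longleftrightarrow> (\<forall>a b. p a = Some b \<longrightarrow> E a b \<and> p b = Some a) \<and>
     (\<forall>a b. E a b \<longrightarrow> satisfied p a b \<or> satisfied p b a)"

definition inside :: "(nat \<Rightarrow> nat option) \<Rightarrow> (nat \<Rightarrow> nat) \<Rightarrow> bool" where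
  "inside p u \<longleftrightarrow> (\<forall>a b. p a = Some b \<longrightarrow> rk a b \<le> u a)"

lemma entry_sym: "entry u a b \<Longrightarrow> entry u b a"
  using E_sym by (auto simp: entry_def)

lemma entry_mono: "entry u a b \<Longrightarrow> (\<And>c. u c \<le> v c) \<Longrightarrow> entry v a b"
  unfolding entry_def using order_trans by blast

lemma suppI: "entry u a b \<Longrightarrow> a \<in> supp u" "entry u a b \<Longrightarrow> b \<in> supp u"
  using entry_sym by (auto simp: supp_def)

lemma supp_mono: "(\<And>c. u c \<le> v c) \<Longrightarrow> supp u \<subseteq> supp v"
  unfolding supp_def using entry_mono by blast

lemma supp_less: "a \<in> supp u \<Longrightarrow> a < n"
  using E_less by (auto simp: supp_def entry_def)

lemma finite_supp: "finite (supp u)"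
  by (rule finite_subset[of _ "{..<n}"]) (auto dest: supp_less)

lemma first_entry: "first u a b \<Longrightarrow> entry u a b"
  by (simp add: first_def)

lemma first_le: "first u a b \<Longrightarrow> entry u a c \<Longrightarrow> rk a b \<le> rk a c"
  by (simp add: first_def)

lemma first_unique: "first u a b \<Longrightarrow> first u a c \<Longrightarrow> b = c"
  using rk_inj unfolding first_def entry_def by (meson le_antisym)

lemma first_exists: "a \<in> supp u \<Longrightarrow> \<exists>b. first u a b"
  using ex_has_least_nat[of "entry u a" _ "rk a"] unfolding supp_def first_def by blast

lemma head_eq: "first u a b \<Longrightarrow> head u a = b"
  unfolding head_def using first_unique by blast

lemma head_first: "a \<in> supp u \<Longrightarrow> first u a (head u a)"
  using first_exists head_eq by metis

lemma closed_first_rk: "closed u \<Longrightarrow> first u a b \<Longrightarrow> rk b a = u b"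
  by (meson entry_def closed_def first_entry le_antisym)

lemma closed_first_inj: "closed u \<Longrightarrow> first u a b \<Longrightarrow> first u c b \<Longrightarrow> a = c"
  by (metis entry_def entry_sym closed_first_rk first_entry rk_inj)

text \<open>The bound of \<open>head u a\<close> is its rank for \<open>a\<close>, which determines
  \<open>a\<close>; so \<open>head u\<close> is injective. An injective map of the finite set
  \<open>supp u\<close> into itself is onto, hence every listed agent is the first entry of
  somebody.\<close>

lemma closed_last:
  assumes "closed u" "b \<in> supp u"
  shows "\<exists>a. first u a b"
proof -
  have "head u ` supp u = supp u"
  proof (rule endo_inj_surj[OF finite_supp])
    show "head u ` supp u \<subseteq> supp u"
    proof
      fix b assume "b \<in> head u ` supp u"
      then obtain a where "a \<in> supp u" "b = head u a" by blast
      then show "b \<in> supp u" using suppI(2)[OF first_entry[OF head_first]] by simp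
    qed
    show "inj_on (head u) (supp u)"
    proof (rule inj_onI)
      fix a c assume "a \<in> supp u" "c \<in> supp u" "head u a = head u c"
      then show "a = c"
        using closed_first_inj[OF assms(1) head_first[of a u]] head_first[of c u] by simp
    qed
  qed
  then show ?thesis using assms(2) head_first by (metis imageE)
qed

lemma stableD: "stable p \<Longrightarrow> p a = Some b \<Longrightarrow> E a b" "stable p \<Longrightarrow> p a = Some b \<Longrightarrow> p b = Some a"
  "stable p \<Longrightarrow> E a b \<Longrightarrow> satisfied p a b \<or> satisfied p b a"
  unfolding stable_def by blast+

lemma inside_entry: "stable p \<Longrightarrow> inside p u \<Longrightarrow> p a = Some b \<Longrightarrow> entry u a b"
  unfolding entry_def inside_def using stableD by blast

text \<open>This is why proposals never cut off a stable matching. If \<open>b\<close> had a partner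
  worse than \<open>a\<close>, the edge would have to be satisfied at \<open>a\<close>; but the
  table offers \<open>a\<close> nothing better than \<open>b\<close>, so \<open>a\<close> and
  \<open>b\<close> would be partners.\<close>

lemma inside_first:
  assumes "stable p" "inside p u" "first u a b" "p b = Some c"
  shows "rk b c \<le> rk b a"
proof (rule ccontr)
  assume "\<not> rk b c \<le> rk b a"
  with assms(4) have "\<not> satisfied p b a" by (simp add: satisfied_def)
  then have "satisfied p a b" using assms(1,3) stableD(3) by (auto simp: first_def entry_def)
  then obtain d where d: "p a = Some d" "rk a d \<le> rk a b" by (auto simp: satisfied_def)
  then have "first u a d"
    using assms by (meson first_def le_trans inside_entry)
  then have "p b = Some a" using d(1) assms(1,3) first_unique stableD(2) by blast
  with assms(4) \<open>\<not> rk b c \<le> rk b a\<close> show False by simp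
qed

text \<open>Every listed \<open>b\<close> is the first entry of some \<open>a\<close>. If
  \<open>b\<close> were unmatched, \<open>a\<close> would need a partner at least as good as
  \<open>b\<close>, and within the table this is only \<open>b\<close> itself. Consequently all
  stable matchings inside a closed table match the same agents.\<close>

lemma dom_inside:
  assumes "stable p" "inside p u" "closed u"
  shows "dom p = supp u"
proof
  show "dom p \<subseteq> supp u" using assms inside_entry suppI by blast
  show "supp u \<subseteq> dom p"
  proof
    fix b assume "b \<in> supp u"
    then obtain a where a: "first u a b" using closed_last assms(3) by blast
    then have "satisfied p b a \<or> satisfied p a b" using assms(1) stableD(3) by (auto simp: first_def entry_def)
    then show "b \<in> dom p"
    proof
      assume "satisfied p a b"
      then obtain d where d: "p a = Some d" "rk a d \<le> rk a b" by (auto simp: satisfied_def)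
      then have "first u a d" using assms a by (meson first_def le_trans inside_entry)
      then show ?thesis using d(1) assms(1) a first_unique stableD(2) by blast
    qed (auto simp: satisfied_def)
  qed
qed

section \<open>Base tables and projection of stable matchings into subtables\<close>

text \<open>The last clause takes care of the edges outside the table: an agent whose bound was
  lowered still has entries, so it is matched by every stable matching, and within its
  bound.\<close>

definition base :: "(nat \<Rightarrow> nat) \<Rightarrow> bool" where
  "base v \<longleftrightarrow> closed v \<and> (\<forall>p. stable p \<longrightarrow> inside p v) \<and> (\<forall>a<n. v a < 3 \<longrightarrow> a \<in> supp v)"

definition good :: "(nat \<Rightarrow> nat) \<Rightarrow> (nat \<Rightarrow> nat) \<Rightarrow> bool" where
  "good v u \<longleftrightarrow> closed u \<and> (\<forall>a. u a \<le> v a) \<and> supp u = supp v"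

text \<open>The stable matching \<open>q\<close> is obtained from \<open>p\<close> by moving every agent to the nearest end of
  its list in the table. An agent that \<open>p\<close> treats better than the first entry is matched by \<open>p\<close> to
  an agent that is treated worse than its last entry, and the latter is the first entry of an
  agent of the former kind; so both kinds are equinumerous and the table matches them up.\<close>

lemma clamp:
  assumes base: "base v" and good: "good v u" and p: "stable p"
  obtains q where "stable q" "inside q u" "\<And>a b. p a = Some b \<Longrightarrow> entry u a b \<Longrightarrow> q a = Some b"
proof -
  have clo: "closed u" and le: "\<And>a. u a \<le> v a" and V: "supp u = supp v"
    using good by (auto simp: good_def)
  have dom: "dom p = supp u"
    using dom_inside base p V by (auto simp: base_def)
  define f where "f = head u"
  define g where "g b = (THE a. first u a b)" for b
  have f: "first u a (f a)" if "a \<in> supp u" for a using that head_first by (simp add: f_def)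
  have g_eq: "g b = a" if "first u a b" for a b
    unfolding g_def using that closed_first_inj[OF clo] by blast
  have g: "first u (g b) b" if "b \<in> supp u" for b
    using closed_last[OF clo that] g_eq by metis
  define P where "P a = the (p a)" for a
  have P: "p a = Some (P a)" if "a \<in> supp u" for a
    using that unfolding P_def dom[symmetric] by auto
  have PP: "P a \<in> supp u" "P (P a) = a" "E a (P a)" if "a \<in> supp u" for a

  proof -
    have "p (P a) = Some a" using P[OF that] p stableD(2) by blast
    then show "P a \<in> supp u" "P (P a) = a" using dom by (auto simp: P_def)
    show "E a (P a)" using P[OF that] p stableD(1) by blast
  qed
  define X where "X = {a \<in> supp u. rk a (P a) < rk a (f a)}"
  define Y where "Y = {a \<in> supp u. u a < rk a (P a)}"
  have XY: "X \<inter> Y = {}"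
  proof -
    have "rk a (f a) \<le> u a" if "a \<in> supp u" for a
      using f[OF that] by (simp add: first_def entry_def)
    then show ?thesis unfolding X_def Y_def by fastforce
  qed
  have PX: "P a \<in> Y" if "a \<in> X" for a
  proof -
    have a: "a \<in> supp u" "rk a (P a) < rk a (f a)" using that by (auto simp: X_def)
    have "\<not> entry u a (P a)" using first_le[OF f[OF a(1)]] a(2) by (meson leD)
    moreover have "rk a (P a) \<le> u a" using a f[of a] by (simp add: first_def entry_def)
    ultimately have "u (P a) < rk (P a) a" using PP[OF a(1)] by (simp add: entry_def)
    then show ?thesis using PP[OF a(1)] by (simp add: Y_def)
  qed
  have gY: "g b \<in> X" if "b \<in> Y" for b
  proof -
    have b: "b \<in> supp u" "u b < rk b (P b)" using that by (auto simp: Y_def)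
    define a where "a = g b"
    have a: "first u a b" "a \<in> supp u"
      using g[OF b(1)] suppI(1)[OF first_entry[OF g[OF b(1)]]] by (simp_all add: a_def)
    have rb: "rk b a = u b" using closed_first_rk clo a by blast
    have Eab: "E a b" using a by (simp add: first_def entry_def)
    \<comment> \<open>\<open>b\<close> would prefer its last entry \<open>a\<close> to its partner,
      so stability must be secured at \<open>a\<close>. As \<open>a\<close> is not matched to
      \<open>b\<close>, it gets something strictly better than its first entry.\<close>
    have "\<not> satisfied p b a" using b rb P[OF b(1)] by (simp add: satisfied_def)
    then have "satisfied p a b" using stableD(3)[OF p Eab] by blast
    then have "rk a (P a) \<le> rk a b" using P[OF a(2)] by (simp add: satisfied_def)
    moreover have "P a \<noteq> b" using rb b PP(2)[OF a(2)] by auto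
    ultimately have "rk a (P a) < rk a b"
      using rk_inj[OF Eab, of "P a"] PP(3)[OF a(2)] by force
    then show ?thesis using a f[OF a(2)] first_unique unfolding X_def a_def[symmetric] by auto
  qed
  have fin: "finite X" "finite Y" using finite_supp by (auto simp: X_def Y_def)
  have injP: "inj_on P X" by (rule inj_onI) (metis PP(2) X_def mem_Collect_eq)
  have injg: "inj_on g Y"
    by (rule inj_onI) (metis (mono_tags, lifting) Y_def first_unique g mem_Collect_eq)
  have "card X \<le> card Y" using card_inj_on_le[OF injP _ fin(2)] PX by blast
  moreover have "card Y \<le> card X" using card_inj_on_le[OF injg _ fin(1)] gY by blast
  ultimately have card: "card X = card Y" by simp
  have PX_eq: "P ` X = Y"
    using card_subset_eq[OF fin(2), of "P ` X"] PX card_image[OF injP] card by auto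
  have gY_eq: "g ` Y = X"
    using card_subset_eq[OF fin(1), of "g ` Y"] gY card_image[OF injg] card by auto
  define q where "q a = (if a \<in> X then Some (f a) else if a \<in> Y then Some (g a) else p a)" for a
  have fX: "f a \<in> Y \<and> g (f a) = a" if "a \<in> X" for a
  proof -
    obtain y where y: "y \<in> Y" "g y = a" using \<open>a \<in> X\<close> gY_eq by blast
    then have "first u a y" using g by (auto simp: Y_def)
    moreover have "first u a (f a)" using f that by (simp add: X_def)
    ultimately have "y = f a" by (rule first_unique)
    then show ?thesis using y by blast
  qed
  have fg: "f (g b) = b" if "b \<in> Y" for b
    using that g[of b] head_eq by (auto simp: Y_def f_def)
  have PY: "P b \<in> X" if "b \<in> Y" for b
  proof -
    obtain a where "a \<in> X" "P a = b" using \<open>b \<in> Y\<close> PX_eq by blast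
    then show ?thesis using PP(2) by (auto simp: X_def)
  qed
  have qT: "entry u a b" if "q a = Some b" for a b
  proof -
    consider "a \<in> X" | "a \<in> Y" "a \<notin> X" | "a \<notin> X" "a \<notin> Y" by blast
    then show ?thesis
    proof cases
      case 1 then show ?thesis using that f first_entry by (auto simp: q_def X_def)
    next
      case 2 then show ?thesis using that g first_entry entry_sym by (auto simp: q_def Y_def)
    next
      case 3
      then have pab: "p a = Some b" using that by (simp add: q_def)
      then have a: "a \<in> supp u" "P a = b" using dom by (auto simp: P_def)
      have "b \<notin> Y" using PY[of b] PP(2)[OF a(1)] a(2) 3 by auto
      then have "rk b a \<le> u b" using PP[OF a(1)] a(2) by (auto simp: Y_def)
      moreover have "rk a b \<le> u a" using 3 a by (auto simp: Y_def)
      ultimately show ?thesis using PP(3)[OF a(1)] a(2) by (simp add: entry_def)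
    qed
  qed
  have q_sym: "q b = Some a" if "q a = Some b" for a b
  proof -
    consider "a \<in> X" | "a \<in> Y" "a \<notin> X" | "a \<notin> X" "a \<notin> Y" by blast
    then show ?thesis
    proof cases
      case 1
      then have b: "b = f a" using that by (simp add: q_def)
      then show ?thesis using fX[OF 1] XY by (auto simp: q_def)
    next
      case 2
      then have b: "b = g a" using that by (simp add: q_def)
      then show ?thesis using gY[OF 2(1)] fg[OF 2(1)] by (auto simp: q_def)
    next
      case 3
      then have pab: "p a = Some b" using that by (simp add: q_def)
      then have a: "a \<in> supp u" "P a = b" using dom by (auto simp: P_def)
      have "b \<notin> Y" using PY[of b] PP(2)[OF a(1)] a(2) 3 by auto
      moreover have "b \<notin> X" using PX[of b] PP(2)[OF a(1)] a(2) 3 by auto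
      ultimately show ?thesis using stableD(2)[OF p pab] by (simp add: q_def)
    qed
  qed
  have q_dom: "\<exists>c. q a = Some c" if "a \<in> supp u" for a
    using P[OF that] by (simp add: q_def)
  have okq: "satisfied q a b" if "entry u a b" "satisfied p a b" for a b
  proof -
    obtain c where c: "p a = Some c" "rk a c \<le> rk a b"
      using \<open>satisfied p a b\<close> by (auto simp: satisfied_def)
    then have Pa: "P a = c" by (simp add: P_def)
    show ?thesis
    proof (cases "a \<in> X")
      case True
      then have "rk a (f a) \<le> rk a b" using first_le[OF f that(1)] by (simp add: X_def)
      then show ?thesis using True by (simp add: satisfied_def q_def)
    next
      case False
      have "rk a b \<le> u a" using that by (simp add: entry_def)
      then have "a \<notin> Y" using c Pa by (auto simp: Y_def)
      then show ?thesis using False c by (simp add: satisfied_def q_def)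
    qed
  qed
  have beyond: "satisfied q a b" if "a \<in> supp u" "u a < rk a b" for a b
  proof -
    obtain c where c: "q a = Some c" using q_dom \<open>a \<in> supp u\<close> by blast
    then have "rk a c \<le> u a" using qT by (simp add: entry_def)
    then show ?thesis using c that by (simp add: satisfied_def)
  qed
  \<comment> \<open>Ranks are at most 3, so a bound below a rank is below 3, and the last clause of
    \<open>base\<close> makes \<open>a\<close> an agent that \<open>q\<close> matches within its
    bound.\<close>
  have beyond': "satisfied q a b" if "v a < rk a b" "E a b" for a b
  proof (rule beyond)
    have "v a < 3" using that rk_le[OF that(2)] by linarith
    then show "a \<in> supp u" using base V that(2) E_less by (auto simp: base_def)
    show "u a < rk a b" using le[of a] that by linarith
  qed
  have "stable q"
    unfolding stable_def
  proof (intro conjI allI impI)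
    fix a b assume E: "E a b"
    then have E': "E b a" by (rule E_sym)
    \<comment> \<open>On entries of \<open>u\<close>, an end satisfied by \<open>p\<close> remains
      satisfied by \<open>q\<close>. On an edge lost between \<open>v\<close> and \<open>u\<close>,
      both ends are listed and the one whose bound is exceeded is satisfied. On an edge outside
      \<open>v\<close>, the end whose bound in \<open>v\<close> is exceeded is satisfied.\<close>
    show "satisfied q a b \<or> satisfied q b a"
    proof (cases "entry u a b")
      case True
      then show ?thesis using okq entry_sym stableD(3)[OF p E] by blast
    next
      case False
      show ?thesis
      proof (cases "entry v a b")
        case True
        then have "a \<in> supp u" "b \<in> supp u" using suppI[OF True] V by auto
        then show ?thesis using beyond False E by (auto simp: entry_def not_le)
      next
        case F: False
        then show ?thesis using beyond' E E' by (auto simp: entry_def not_le)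
      qed
    qed
  next
    fix a b assume "q a = Some b"
    then show "E a b" "q b = Some a" using qT[of a b] q_sym[of a b] by (auto simp: entry_def)
  qed
  moreover have "inside q u" using qT by (auto simp: inside_def entry_def)
  moreover have "q a = Some b" if "p a = Some b" "entry u a b" for a b
  proof -
    have a: "a \<in> supp u" "P a = b" using that dom by (auto simp: P_def)
    have "a \<notin> X" using first_le[OF f[OF a(1)] that(2)] a by (simp add: X_def)
    moreover have "a \<notin> Y" using that(2) a by (auto simp: Y_def entry_def)
    ultimately show ?thesis using that by (simp add: q_def)
  qed
  ultimately show thesis using that by blast
qed

end

section \<open>Closing a table and branching\<close>

context roommates
begin

text \<open>A proposal of \<open>a\<close> to its first entry, which then rejects everybody it likes
  less than \<open>a\<close>. Since an entry needs both bounds, lowering the receiver's bound also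
  removes it from the lists of those rejected.\<close>

definition step :: "nat \<Rightarrow> (nat \<Rightarrow> nat) \<Rightarrow> nat \<Rightarrow> nat" where
  "step a u = (if a \<in> supp u then u(head u a := min (u (head u a)) (rk (head u a) a)) else u)"

definition sweep :: "(nat \<Rightarrow> nat) \<Rightarrow> nat \<Rightarrow> nat" where
  "sweep u = fold step [0..<n] u"

text \<open>On \<open>n\<close> agents with bounds at most 3 the sum of the bounds is at most
  \<open>3 * n\<close>, and a sweep that changes anything decreases it. So one of
  \<open>3 * n + 1\<close> sweeps is stationary, and the fixed number spares a test for it.\<close>

definition reduce :: "(nat \<Rightarrow> nat) \<Rightarrow> nat \<Rightarrow> nat" where
  "reduce = sweep ^^ Suc (3 * n)"

lemma step_le: "step a u c \<le> u c"
  by (simp add: step_def)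

lemma fold_step_le: "fold step xs u c \<le> u c"
  by (induction xs arbitrary: u) (auto intro: order_trans[OF _ step_le])

lemma sweep_le: "sweep u c \<le> u c"
  by (simp add: sweep_def fold_step_le)

lemma fold_step_fixed: "fold step xs u = u \<Longrightarrow> a \<in> set xs \<Longrightarrow> step a u = u"
proof (induction xs arbitrary: u)
  case (Cons x xs)
  have "step x u c = u c" for c
    using fold_step_le[of xs "step x u" c] step_le[of x u c] Cons.prems(1)
    by (metis fold_simps(2) le_antisym)
  then have "step x u = u" by blast
  then show ?case using Cons by auto
qed simp

lemma head_less: "a \<in> supp u \<Longrightarrow> head u a < n"
  using supp_less suppI(2)[OF first_entry[OF head_first]] by blast

lemma fold_step_outside: "n \<le> c \<Longrightarrow> fold step xs u c = u c"
proof (induction xs arbitrary: u)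
  case (Cons x xs)
  have "step x u c = u c" using Cons.prems head_less[of x u] by (auto simp: step_def)
  then show ?case using Cons by simp
qed simp

lemma closed_fixed:
  assumes "sweep u = u"
  shows "closed u"
  unfolding closed_def
proof (intro allI impI)
  fix a b assume first: "first u a b"
  then have a: "a \<in> supp u" using suppI(1)[OF first_entry] by blast
  then have "step a u = u" using assms fold_step_fixed supp_less by (auto simp: sweep_def)
  then have "min (u b) (rk b a) = u b"
    using a head_eq[OF first] by (metis fun_upd_same step_def)
  then show "u b \<le> rk b a" by simp
qed

lemma sum_sweep:
  assumes "sweep u \<noteq> u"
  shows "(\<Sum>i<n. sweep u i) < (\<Sum>i<n. u i)"
proof -
  obtain c where c: "sweep u c \<noteq> u c" using assms by blast
  then have "c < n" using fold_step_outside by (metis not_le sweep_def)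
  then show ?thesis
    using c sweep_le[of u] by (intro sum_strict_mono_ex1) (auto intro!: bexI[of _ c] simp: le_neq_implies_less)
qed

lemma iterate_sweep:
  "sweep ((sweep ^^ k) u) = (sweep ^^ k) u \<or> (\<Sum>i<n. (sweep ^^ k) u i) + k \<le> (\<Sum>i<n. u i)"
proof (induction k)
  case (Suc k)
  show ?case
  proof (cases "sweep ((sweep ^^ k) u) = (sweep ^^ k) u")
    case False
    then show ?thesis using Suc sum_sweep[OF False] by simp
  qed simp
qed simp

lemma closed_reduce:
  assumes "\<And>a. a < n \<Longrightarrow> u a \<le> 3"
  shows "closed (reduce u)"
proof (rule closed_fixed, rule ccontr)
  assume "sweep (reduce u) \<noteq> reduce u"
  then have "Suc (3 * n) \<le> (\<Sum>i<n. u i)"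
    using iterate_sweep[of "Suc (3 * n)" u] unfolding reduce_def by linarith
  also have "\<dots> \<le> (\<Sum>i<n. 3)" using assms by (intro sum_mono) simp
  finally show False by simp
qed

lemma reduce_le: "reduce u c \<le> u c"
proof -
  have "(sweep ^^ k) u c \<le> u c" for k
    by (induction k) (auto intro: order_trans[OF sweep_le])
  then show ?thesis by (simp only: reduce_def)
qed

text \<open>Invariants of the closing process need to be checked for a single effective proposal
  only.\<close>

lemma reduce_induct:
  assumes "P u" "\<And>u a. P u \<Longrightarrow> a \<in> supp u \<Longrightarrow> P (step a u)"
  shows "P (reduce u)"
proof -
  have step: "P (step a u)" if "P u" for a u
    using assms(2)[OF that] that by (cases "a \<in> supp u") (auto simp: step_def)
  have "P (fold step xs u)" if "P u" for xs u
    using that by (induction xs arbitrary: u) (auto simp: step)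
  then have "P (sweep u)" if "P u" for u using that by (simp add: sweep_def)
  then have "P ((sweep ^^ k) u)" for k using assms(1) by (induction k) auto
  then show ?thesis by (simp only: reduce_def)
qed

lemma inside_reduce:
  assumes "stable p" "inside p u"
  shows "inside p (reduce u)"
proof (rule reduce_induct[where P = "inside p", OF assms(2)])
  fix u a assume u: "inside p u" "a \<in> supp u"
  then show "inside p (step a u)"
    using inside_first[OF assms(1) u(1) head_first[OF u(2)]] by (auto simp: inside_def step_def)
qed

text \<open>Bounds drop only through proposals, and whoever has received one keeps being the first
  entry of somebody: the last rank it accepts belongs to an agent that has nothing better.\<close>

lemma base_reduce:
  assumes u: "\<And>a. a < n \<Longrightarrow> u a = 3"
  shows "base (reduce u)"
proof -
  have "closed (reduce u)" using closed_reduce u by simp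
  moreover have "inside p (reduce u)" if "stable p" for p
  proof (rule inside_reduce[OF that])
    have "rk a b \<le> u a" if "p a = Some b" for a b
      using stableD(1)[OF \<open>stable p\<close> that] E_less rk_le u by fastforce
    then show "inside p u" by (simp add: inside_def)
  qed
  \<comment> \<open>Naming the agent \<open>c\<close> whose first entry is \<open>a\<close> turns
    the clause into an inductive invariant.\<close>
  moreover have "\<forall>a<n. reduce u a < 3 \<longrightarrow> (\<exists>c. first (reduce u) c a)"
  proof (rule reduce_induct[where P = "\<lambda>w. \<forall>a<n. w a < 3 \<longrightarrow> (\<exists>c. first w c a)"])
    fix w a assume w: "\<forall>a<n. w a < 3 \<longrightarrow> (\<exists>c. first w c a)" and a: "a \<in> supp w"
    define b where "b = head w a"
    have ab: "first w a b" using a head_first by (simp add: b_def)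
    define w' where "w' = step a w"
    have w': "w' = w(b := min (w b) (rk b a))" using a by (simp add: w'_def step_def b_def)
    have mono: "first w' c y" if "first w c y" "entry w' c y" for c y
      using that entry_mono[of w' c _ w] step_le[of a w] by (auto simp: first_def w'_def)
    have "\<exists>c. first w' c y" if y: "y < n" "w' y < 3" for y
    proof (cases "y = b")
      case True
      have "entry w' a b"
        using first_entry[OF ab] by (auto simp: entry_def w')
      then show ?thesis using mono ab True by blast
    next
      case False
      then obtain c where c: "first w c y" using w y by (auto simp: w')
      \<comment> \<open>The critical case: the agent whose first entry is \<open>y\<close> is
        \<open>b\<close>, whose bound has just dropped to \<open>rk b a\<close>. Its first entry
        survives because \<open>b\<close> likes it at least as much as \<open>a\<close>.\<close>
      have "rk b y \<le> rk b a" if "c = b"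
        using first_le[of w b y a] c that entry_sym[OF first_entry[OF ab]] by blast
      then have "entry w' c y" using first_entry[OF c] False by (auto simp: entry_def w')
      then show ?thesis using mono c by blast
    qed
    then show "\<forall>y<n. step a w y < 3 \<longrightarrow> (\<exists>c. first (step a w) c y)" by (simp add: w'_def)
  qed (use u in auto)
  ultimately show ?thesis using suppI(2)[OF first_entry] unfolding base_def by blast
qed

section \<open>Branching and the agents it forces to their first entries\<close>

lemma good_refl: "base v \<Longrightarrow> good v v"
  by (simp add: good_def base_def)

text \<open>A single stable matching inside both closed tables has both supports as its domain, so
  no list has become empty.\<close>

lemma good_inside:
  assumes "base v" "closed w" "\<And>a. w a \<le> v a" "stable q" "inside q w"
  shows "good v w"
  using assms dom_inside[of q w] dom_inside[of q v] by (auto simp: good_def base_def)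

text \<open>As \<open>v a\<close> is the rank of the last entry if \<open>v\<close> is closed, these agents have two entries.\<close>

definition duo :: "(nat \<Rightarrow> nat) \<Rightarrow> nat set" where
  "duo v = {a \<in> supp v. v a = Suc (rk a (head v a))}"

definition happy :: "(nat \<Rightarrow> nat) \<Rightarrow> (nat \<Rightarrow> nat option) \<Rightarrow> nat set" where
  "happy v p = {a \<in> duo v. p a = Some (head v a)}"

lemma finite_duo: "finite (duo v)"
  using finite_supp by (simp add: duo_def)

text \<open>In a closed table the bound of \<open>head u a\<close> equals its rank for
  \<open>a\<close>, so decreasing it by one deletes exactly the entry shared with
  \<open>a\<close>.\<close>

definition drop_first :: "(nat \<Rightarrow> nat) \<Rightarrow> nat \<Rightarrow> nat \<Rightarrow> nat" where
  "drop_first u a = reduce (u(head u a := u (head u a) - 1))"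

definition drop_last :: "(nat \<Rightarrow> nat) \<Rightarrow> nat \<Rightarrow> nat \<Rightarrow> nat" where
  "drop_last u a = reduce (u(a := u a - 1))"

lemma drop_le: "drop_first u a c \<le> u c" "drop_last u a c \<le> u c"
  unfolding drop_first_def drop_last_def by (rule order_trans[OF reduce_le], simp)+

text \<open>The matching \<open>p\<close> itself need not lie in \<open>w\<close> or in
  \<open>u\<close>; what is recorded is only that it gives their first entries to all the agents of
  \<open>duo v\<close> whose bounds the branch lowers.\<close>

definition forced :: "(nat \<Rightarrow> nat) \<Rightarrow> (nat \<Rightarrow> nat) \<Rightarrow> (nat \<Rightarrow> nat) \<Rightarrow> (nat \<Rightarrow> nat option) \<Rightarrow> bool" where
  "forced v u w p \<longleftrightarrow> good v w \<and> (\<forall>i\<in>duo v. w i < u i \<longrightarrow> p i = Some (head v i))"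

text \<open>In \<open>v\<close> the agent \<open>b\<close> has only a first and a last entry.
  Suppose \<open>p\<close> gives it the last one. As \<open>q\<close> matches \<open>b\<close>
  within \<open>w b < u b\<close>, the bound \<open>u b\<close> is still the full
  \<open>v b\<close>; so the last entry survives in \<open>u\<close>, the projection
  \<open>q\<close> retains this pair, and its rank exceeds \<open>w b\<close>, a
  contradiction.\<close>

lemma forced_first:
  assumes base: "base v" and good: "good v u" and p: "stable p"
    and q: "stable q" "inside q w" "\<And>a b. p a = Some b \<Longrightarrow> entry u a b \<Longrightarrow> q a = Some b"
    and b: "b \<in> duo v" "w b < u b"
  shows "p b = Some (head v b)"
proof (rule ccontr)
  assume contra: "p b \<noteq> Some (head v b)"
  have clo: "closed u" "closed v" and le: "\<And>a. u a \<le> v a" and V: "supp u = supp v"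
    and in_v: "\<And>p. stable p \<Longrightarrow> inside p v"
    using base good by (auto simp: good_def base_def)
  have b': "b \<in> supp v" "v b = Suc (rk b (head v b))" using b by (auto simp: duo_def)
  note h = head_first[OF b'(1)]
  obtain c d where cd: "q b = Some c" "p b = Some d"
    using dom_inside[OF q(1) in_v clo(2)] dom_inside[OF p in_v clo(2)] q(1) p b'(1) by blast
  have c: "entry v b c" and d: "entry v b d" using inside_entry in_v q(1) p cd by blast+
  have "d \<noteq> head v b" using contra cd by simp
  then have "rk b d \<noteq> rk b (head v b)" using d first_entry[OF h] rk_inj by (auto simp: entry_def)
  then have rd: "rk b d = v b"
    using first_le[OF h d] d b'(2) by (simp add: entry_def)
  have "rk b (head v b) \<le> rk b c" using first_le[OF h c] .
  moreover have rc: "rk b c \<le> w b" using q(2) cd by (simp add: inside_def)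
  ultimately have ub: "u b = v b" using b b'(2) le[of b] by simp
  obtain a where a: "first u a b" using closed_last[OF clo(1)] b'(1) V by blast
  have "rk b a = rk b d" using closed_first_rk[OF clo(1) a] ub rd by simp
  then have "a = d" using d entry_sym[OF first_entry[OF a]] rk_inj[of b a d] by (auto simp: entry_def)
  then have "q b = Some d" using q(3)[OF cd(2)] entry_sym[OF first_entry[OF a]] by blast
  then show False using cd rc rd ub b by simp
qed

text \<open>The projection \<open>q\<close> of \<open>p\<close> into \<open>u\<close> selects the
  branch: if \<open>q\<close> gives \<open>a\<close> its first entry it survives the deletion of the
  last one, and otherwise it survives the deletion of the first one.\<close>

lemma forced_cases:
  assumes base: "base v" and v3: "\<And>a. a < n \<Longrightarrow> v a \<le> 3" and good: "good v u"
    and a: "a \<in> supp v" "rk a (head u a) < u a" and p: "stable p"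
  shows "forced v u (drop_first u a) p \<or> forced v u (drop_last u a) p"
proof -
  have clo: "closed u" and le: "\<And>a. u a \<le> v a" and V: "supp u = supp v"
    using good by (auto simp: good_def)
  define b where "b = head u a"
  have ab: "first u a b" using head_first a V by (simp add: b_def)
  obtain q where q: "stable q" "inside q u" "\<And>a b. p a = Some b \<Longrightarrow> entry u a b \<Longrightarrow> q a = Some b"
    by (rule clamp[OF base good p]) (rule that, assumption+)
  have main: "forced v u (reduce w) p" if w: "inside q w" "\<And>c. w c \<le> u c" for w
  proof -
    have in_w: "inside q (reduce w)" using inside_reduce[OF q(1) w(1)] .
    have rle: "reduce w c \<le> v c" for c
      using reduce_le[of w c] w(2)[of c] le[of c] by linarith
    have "w c \<le> 3" if "c < n" for c using w(2)[of c] le[of c] v3[OF that] by linarith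
    then have "good v (reduce w)"
      using good_inside[OF base closed_reduce rle q(1) in_w] by simp
    then show ?thesis
      using forced_first[OF base good p q(1) in_w q(3)] by (simp add: forced_def)
  qed
  show ?thesis
  proof (cases "q a = Some b")
    case True
    have "inside q (u(a := u a - 1))"
      using q(2) True a(2) by (auto simp: inside_def b_def)
    then show ?thesis using main[of "u(a := u a - 1)"] by (simp add: drop_last_def)
  next
    case False
    have "rk b c \<le> u b - 1" if "q b = Some c" for c
    proof -
      have "c \<noteq> a" using False stableD(2)[OF q(1) that] by auto
      moreover have "entry u b c" using inside_entry q that by blast
      ultimately have "rk b c \<noteq> rk b a" using rk_inj entry_sym[OF first_entry[OF ab]] by (auto simp: entry_def)
      then show ?thesis
        using closed_first_rk[OF clo ab] \<open>entry u b c\<close> unfolding entry_def by linarith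
    qed
    then have "inside q (u(b := u b - 1))" using q(2) by (auto simp: inside_def)
    then show ?thesis using main[of "u(b := u b - 1)"] by (simp add: drop_first_def b_def)
  qed
qed

section \<open>Progress measure and charging\<close>

definition gap :: "(nat \<Rightarrow> nat) \<Rightarrow> nat \<Rightarrow> nat" where
  "gap u a = u a - rk a (head u a)"

lemma gap_mono:
  assumes "\<And>c. w c \<le> u c" "a \<in> supp w"
  shows "gap w a \<le> gap u a"
proof -
  have "entry u a (head w a)" using entry_mono[OF first_entry[OF head_first[OF assms(2)]]] assms(1) by blast
  then have "rk a (head u a) \<le> rk a (head w a)"
    using first_le[OF head_first] suppI(1) by blast
  then show ?thesis using assms(1)[of a] by (simp add: gap_def)
qed

text \<open>The old head no longer accepts \<open>a\<close>, since its rank for \<open>a\<close> was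
  its bound; so the new first entry of \<open>a\<close> has a strictly larger rank, while the bound
  of \<open>a\<close> does not grow.\<close>

lemma gap_drop_first:
  assumes "closed u" "a \<in> supp (drop_first u a)" "0 < gap u a"
  shows "gap (drop_first u a) a < gap u a"
proof -
  define w where "w = drop_first u a"
  have le: "w c \<le> u c" for c using drop_le by (simp add: w_def)
  define b where "b = head w a"
  have ab: "entry w a b" using head_first[OF assms(2)] by (simp add: b_def w_def first_entry)
  then have Tu: "entry u a b" using entry_mono le by blast
  then have h: "first u a (head u a)" using head_first suppI(1) by blast
  have "b \<noteq> head u a"
  proof
    assume b: "b = head u a"
    have "w b \<le> u b - 1"
      unfolding w_def drop_first_def b[symmetric]
      by (rule order_trans[OF reduce_le]) simp
    moreover have "rk b a = u b" using closed_first_rk[OF assms(1) h] b by simp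
    moreover have "0 < rk b a" using ab rk_pos E_sym by (simp add: entry_def)
    ultimately show False using ab unfolding entry_def by linarith
  qed
  then have "rk a (head u a) < rk a b"
    using first_le[OF h Tu] rk_inj[of a "head u a" b] first_entry[OF h] Tu by (force simp: entry_def)
  then show ?thesis
    using le[of a] assms(3) by (simp add: gap_def w_def[symmetric] b_def[symmetric])
qed

lemma gap_drop_last:
  assumes "a \<in> supp (drop_last u a)" "0 < gap u a"
  shows "gap (drop_last u a) a < gap u a"
proof -
  define w where "w = drop_last u a"
  have le: "w c \<le> u c" for c using drop_le by (simp add: w_def)
  have "w a \<le> u a - 1"
    unfolding w_def drop_last_def by (rule order_trans[OF reduce_le]) simp
  moreover have "entry u a (head w a)"
    using entry_mono[OF first_entry[OF head_first[OF assms(1)]]] le by (auto simp: w_def)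
  then have "rk a (head u a) \<le> rk a (head w a)"
    using first_le[OF head_first] suppI(1) by blast
  ultimately show ?thesis using assms(2) by (simp add: gap_def w_def[symmetric])
qed

text \<open>\<open>R\<close> is the set of the agents that have not been charged yet.\<close>

definition invar :: "(nat \<Rightarrow> nat) \<Rightarrow> (nat \<Rightarrow> nat) \<Rightarrow> nat set \<Rightarrow> bool" where
  "invar v u R \<longleftrightarrow> good v u \<and> R \<subseteq> duo v \<and> (\<forall>b\<in>R. u b = v b) \<and>
     (\<forall>p. stable p \<longrightarrow> card (duo v - R) \<le> 2 * card (happy v p - R))"

text \<open>The second summand makes a branch with a new empty list more expensive than any other.\<close>

definition price :: "(nat \<Rightarrow> nat) \<Rightarrow> (nat \<Rightarrow> nat) \<Rightarrow> nat set \<Rightarrow> (nat \<Rightarrow> nat) \<Rightarrow> nat" where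
  "price v u R w = card {i \<in> R. w i < u i} + Suc n * card (supp v - supp w)"

lemma price_good: "good v w \<Longrightarrow> price v u R w = card {i \<in> R. w i < u i}"
  by (simp add: price_def good_def)

text \<open>Here \<open>w\<close> is the executed branch, \<open>l\<close> the rejected one and
  \<open>R - R'\<close> the set of newly charged agents. If \<open>p\<close> follows
  \<open>w\<close>, the agents lowered by \<open>w\<close> are happy and all of them leave
  \<open>R\<close>. If \<open>p\<close> follows \<open>l\<close>, at least as many agents of
  \<open>R\<close> are lowered by \<open>l\<close> as by \<open>w\<close>, and either enough of them
  or all of them are charged. So twice the gain in happy agents covers the new charges.\<close>

lemma invar_commit:
  assumes invar: "invar v u R"
    and forced: "\<And>p. stable p \<Longrightarrow> forced v u w p \<or> forced v u l p"
    and solv: "stable p0"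
    and w: "\<And>c. w c \<le> u c" "closed w" and price: "price v u R w \<le> price v u R l"
    and R': "R' \<subseteq> R" "\<And>i. i \<in> R' \<Longrightarrow> w i = u i"
      "card (R - R') \<le> 2 * price v u R w"
      "price v u R w \<le> card {i \<in> R - R'. l i < u i} \<or> (\<forall>i\<in>R'. \<not> l i < u i)"
  shows "invar v w R'"
proof -
  have good: "good v u" and RD: "R \<subseteq> duo v" and Rv: "\<And>b. b \<in> R \<Longrightarrow> u b = v b"
    and pay: "\<And>p. stable p \<Longrightarrow> card (duo v - R) \<le> 2 * card (happy v p - R)"
    using invar by (auto simp: invar_def)
  have finR: "finite R" using RD finite_duo finite_subset by blast
  have card_n: "card {i \<in> R. x i < u i} \<le> n" for x
  proof -
    have "card {i \<in> R. x i < u i} \<le> card {..<n}"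
      by (rule card_mono) (use RD supp_less in \<open>auto simp: duo_def\<close>)
    then show ?thesis by simp
  qed
  \<comment> \<open>If the cheaper branch lost a listed agent, its price would be at least
    \<open>Suc n\<close>. But then \<open>p0\<close> follows \<open>l\<close>, whose price is at
    most \<open>n\<close>.\<close>
  have gw: "good v w"
  proof (rule ccontr)
    assume bad: "\<not> good v w"
    then have "forced v u l p0" using forced[OF solv] by (auto simp: forced_def)
    then have "price v u R l \<le> n" using price_good card_n by (auto simp: forced_def)
    moreover have le: "w c \<le> v c" for c using w(1)[of c] good by (meson good_def order_trans)
    have "supp v - supp w \<noteq> {}"
      using bad w(2) le supp_mono[of w v] by (auto simp: good_def)
    then have "0 < card (supp v - supp w)"
      using finite_supp card_gt_0_iff by blast
    then have "Suc n * 1 \<le> Suc n * card (supp v - supp w)" by (intro mult_le_mono2) simp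
    then have "Suc n \<le> price v u R w" by (simp add: price_def)
    ultimately show False using price by linarith
  qed
  define c where "c = card {i \<in> R. w i < u i}"
  have pw: "price v u R w = c" using price_good[OF gw] by (simp add: c_def)
  have "card (duo v - R') \<le> 2 * card (happy v p - R')" if p: "stable p" for p
  proof -
    \<comment> \<open>Whichever branch \<open>p\<close> follows, at least \<open>c\<close> newly
      charged agents are happy.\<close>
    have c_le: "c \<le> card (happy v p \<inter> (R - R'))"
    proof -
      have fin: "finite (happy v p \<inter> (R - R'))" using finR by blast
      consider "forced v u w p" | "forced v u l p" using forced[OF p] by blast
      then show ?thesis
      proof cases
        case 1
        have "{i \<in> R. w i < u i} \<subseteq> happy v p \<inter> (R - R')"
        proof
          fix i assume i: "i \<in> {i \<in> R. w i < u i}"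
          then have "i \<notin> R'" using R'(2)[of i] by auto
          then show "i \<in> happy v p \<inter> (R - R')"
            using 1 RD i by (auto simp: forced_def happy_def)
        qed
        then show ?thesis unfolding c_def by (rule card_mono[OF fin])
      next
        case 2
        then have "c \<le> card {i \<in> R. l i < u i}"
          using price pw price_good by (auto simp: forced_def)
        moreover have "{i \<in> R. l i < u i} = {i \<in> R - R'. l i < u i}" if "\<forall>i\<in>R'. \<not> l i < u i"
          using that by auto
        ultimately have "c \<le> card {i \<in> R - R'. l i < u i}" using R'(4) pw by auto
        also have "\<dots> \<le> card (happy v p \<inter> (R - R'))"
          using 2 RD by (intro card_mono[OF fin]) (auto simp: forced_def happy_def)
        finally show ?thesis .
      qed
    qed
    have "card (duo v - R') = card ((duo v - R) \<union> (R - R'))"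
      by (rule arg_cong[where f = card]) (use RD R'(1) in auto)
    also have "\<dots> \<le> card (duo v - R) + card (R - R')" by (rule card_Un_le)
    also have "\<dots> \<le> 2 * (card (happy v p - R) + card (happy v p \<inter> (R - R')))"
      using pay[OF p] R'(3) pw c_le by simp
    also have "card (happy v p - R) + card (happy v p \<inter> (R - R'))
        = card ((happy v p - R) \<union> (happy v p \<inter> (R - R')))"
      by (rule card_Un_disjoint[symmetric]) (use finite_duo finR in \<open>auto simp: happy_def\<close>)
    also have "(happy v p - R) \<union> (happy v p \<inter> (R - R')) = happy v p - R'"
      using R'(1) by auto
    finally show ?thesis .
  qed
  moreover have "\<forall>b\<in>R'. w b = v b" using R'(1,2) Rv by auto
  ultimately show ?thesis using gw R'(1) RD by (auto simp: invar_def)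
qed

lemma invar_init: "base v \<Longrightarrow> invar v v (duo v)"
  by (simp add: invar_def good_refl)

section \<open>Cost of a stable matching as a constant plus the number of happy agents\<close>

definition total :: "(nat \<Rightarrow> nat) \<Rightarrow> (nat \<Rightarrow> nat option) \<Rightarrow> nat" where
  "total v p = (\<Sum>a\<in>supp v. rk a (the (p a)))"

definition floor_cost :: "(nat \<Rightarrow> nat) \<Rightarrow> nat \<Rightarrow> nat" where
  "floor_cost v a = (if v a = rk a (head v a) + 2 then Suc (rk a (head v a)) else rk a (head v a))"

text \<open>Adding 1 to the ranks of first entries and subtracting 1 from those of last entries does not
  change the sum, but makes the summands independent of the matching except on \<open>duo v\<close>.\<close>

lemma total_eq:
  assumes base: "base v" and v3: "\<And>a. a < n \<Longrightarrow> v a \<le> 3" and p: "stable p"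
  shows "total v p = (\<Sum>a\<in>supp v. floor_cost v a) + card (happy v p)"
proof -
  have clo: "closed v" and ins: "inside p v" using base p by (auto simp: base_def)
  have dom: "dom p = supp v" using dom_inside[OF p ins clo] .
  define H where "H = {a \<in> supp v. p a = Some (head v a)}"
  define L where "L = {a \<in> supp v. rk a (the (p a)) = v a}"
  \<comment> \<open>The agents with their first entry and those with their last one are partners of
    each other, so the corrections by 1 cancel in the sum.\<close>
  have "bij_betw (head v) H L"
  proof (rule bij_betwI')
    fix a b assume "a \<in> H" "b \<in> H"
    then have "p (head v a) = Some a" "p (head v b) = Some b"
      using stableD(2)[OF p] unfolding H_def by blast+
    then show "head v a = head v b \<longleftrightarrow> a = b" by (metis option.inject)
  next
    fix a assume "a \<in> H"
    then have a: "a \<in> supp v" "p a = Some (head v a)" by (auto simp: H_def)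
    note h = head_first[OF a(1)]
    show "head v a \<in> L"
      using closed_first_rk[OF clo h] stableD(2)[OF p a(2)] suppI(2)[OF first_entry[OF h]]
      by (simp add: L_def)
  next
    fix b assume "b \<in> L"
    then have b: "b \<in> supp v" "rk b (the (p b)) = v b" by (auto simp: L_def)
    obtain a where a: "first v a b" using closed_last[OF clo b(1)] by blast
    obtain d where d: "p b = Some d" using b(1) dom by blast
    have "rk b a = rk b d" using closed_first_rk[OF clo a] b(2) d by simp
    then have "a = d" using rk_inj[of b a d] inside_entry[OF p ins d] entry_sym[OF first_entry[OF a]]
      by (auto simp: entry_def)
    then have "p a = Some b" using stableD(2)[OF p d] by simp
    then show "\<exists>a\<in>H. b = head v a"
      using head_eq[OF a] suppI(1)[OF first_entry[OF a]] by (intro bexI[of _ a]) (auto simp: H_def)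
  qed
  then have HL: "card H = card L" by (rule bij_betw_same_card)
  \<comment> \<open>Let \<open>r\<close> be the first rank; lists of length at most 3 have
    \<open>v a - r\<close> at most 2. For difference 0 the agent is in both \<open>H\<close> and
    \<open>L\<close>; for 1 the corrected rank is \<open>r + 1\<close> or \<open>r\<close>, which is
    what \<open>happy\<close> counts; for 2 all of \<open>r\<close>, \<open>r + 1\<close>,
    \<open>r + 2\<close> are corrected to \<open>r + 1\<close>.\<close>
  have pointwise: "rk a (the (p a)) + (if a \<in> H then 1 else 0)
      = floor_cost v a + (if a \<in> happy v p then 1 else 0) + (if a \<in> L then 1 else 0)"
    if a: "a \<in> supp v" for a
  proof -
    obtain d where d: "p a = Some d" using a dom by blast
    note h = head_first[OF a]
    have Td: "entry v a d" using inside_entry[OF p ins d] .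
    have "rk a (head v a) \<le> rk a d" "rk a d \<le> v a" "v a \<le> 3" "0 < rk a (head v a)"
      using first_le[OF h Td] Td v3[OF supp_less[OF a]] first_entry[OF h] rk_pos by (auto simp: entry_def)
    moreover have "d = head v a \<longleftrightarrow> rk a d = rk a (head v a)"
      using rk_inj[of a d] Td first_entry[OF h] by (auto simp: entry_def)
    ultimately show ?thesis
      using a d by (auto simp: H_def L_def happy_def duo_def floor_cost_def)
  qed
  have card_if: "(\<Sum>a\<in>supp v. if a \<in> S then 1 else 0) = card S" if "S \<subseteq> supp v" for S
    using that finite_supp by (simp add: sum.If_cases Int_absorb1)
  have sub: "H \<subseteq> supp v" "L \<subseteq> supp v" "happy v p \<subseteq> supp v"
    by (auto simp: H_def L_def happy_def duo_def)
  have "total v p + card H = (\<Sum>a\<in>supp v. floor_cost v a) + card (happy v p) + card L"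
    using sum.cong[OF refl pointwise, of "supp v" "\<lambda>x. x"] card_if[OF sub(1)] card_if[OF sub(2)]
      card_if[OF sub(3)] by (simp add: sum.distrib total_def)
  then show ?thesis using HL by simp
qed

text \<open>The partner of a happy agent has its last entry. Were it happy too, the same agent would
  be its first and its last entry, which \<open>duo\<close> excludes. So the happy agents and their
  partners form disjoint sets of equal size within \<open>supp v\<close>, and every agent there has
  \<open>floor_cost\<close> at least 1.\<close>

lemma floor_cost_ge:
  assumes base: "base v" and p: "stable p"
  shows "2 * card (happy v p) \<le> (\<Sum>a\<in>supp v. floor_cost v a)"
proof -
  have clo: "closed v" using base by (simp add: base_def)
  let ?W = "happy v p"
  have W: "a \<in> supp v" "v a = Suc (rk a (head v a))" "p a = Some (head v a)" if "a \<in> ?W" for a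
    using that by (auto simp: happy_def duo_def)
  have inj: "inj_on (head v) ?W"
  proof (rule inj_onI)
    fix a b assume "a \<in> ?W" "b \<in> ?W" "head v a = head v b"
    then show "a = b"
      using stableD(2)[OF p W(3)[of a]] stableD(2)[OF p W(3)[of b]] by (metis option.inject)
  qed
  have disj: "?W \<inter> head v ` ?W = {}"
  proof (rule ccontr)
    assume "?W \<inter> head v ` ?W \<noteq> {}"
    then obtain a where a: "a \<in> ?W" "head v a \<in> ?W" by auto
    define b where "b = head v a"
    have "p b = Some a" using stableD(2)[OF p W(3)[OF a(1)]] by (simp add: b_def)
    then have "head v b = a" using W(3)[of b] a(2) by (simp add: b_def)
    moreover have "rk b a = v b"
      using closed_first_rk[OF clo head_first[OF W(1)[OF a(1)]]] by (simp add: b_def)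
    ultimately show False using W(2)[of b] a(2) by (simp add: b_def)
  qed
  have fin: "finite ?W" using finite_duo by (simp add: happy_def)
  have "2 * card ?W = card (?W \<union> head v ` ?W)"
    using card_Un_disjoint[OF fin _ disj] fin card_image[OF inj] by simp
  also have "\<dots> \<le> card (supp v)"
    using W(1) suppI(2)[OF first_entry[OF head_first]] by (intro card_mono finite_supp) blast
  also have "\<dots> = (\<Sum>a\<in>supp v. 1)" by simp
  also have "\<dots> \<le> (\<Sum>a\<in>supp v. floor_cost v a)"
  proof (rule sum_mono)
    fix a assume "a \<in> supp v"
    then have "0 < rk a (head v a)" using first_entry[OF head_first] rk_pos by (auto simp: entry_def)
    then show "1 \<le> floor_cost v a" by (simp add: floor_cost_def)
  qed
  finally show ?thesis .
qed

text \<open>A table with one entry per list contains exactly one stable matching, namely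
  \<open>q\<close>, and its existence comes from projecting \<open>p\<close>. Agents that were never
  charged have kept their last entry, so the happy agents of \<open>q\<close> are all among the
  charged ones.\<close>

lemma invar_approx:
  assumes base: "base v" and v3: "\<And>a. a < n \<Longrightarrow> v a \<le> 3" and invar: "invar v u R"
    and single: "\<And>a. a \<in> supp u \<Longrightarrow> gap u a = 0" and p: "stable p"
  defines "q \<equiv> \<lambda>a. if a \<in> supp u then Some (head u a) else None"
  shows "stable q" "7 * total v q \<le> 9 * total v p"
proof -
  have good: "good v u" and RD: "R \<subseteq> duo v" and Rv: "\<And>b. b \<in> R \<Longrightarrow> u b = v b"
    and pay: "\<And>p. stable p \<Longrightarrow> card (duo v - R) \<le> 2 * card (happy v p - R)"
    using invar by (auto simp: invar_def)
  have clo: "closed u" and V: "supp u = supp v" using good by (auto simp: good_def)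
  obtain r where r: "stable r" "inside r u" by (rule clamp[OF base good p])
  have "r a = q a" for a
  proof (cases "a \<in> supp u")
    case True
    then obtain d where d: "r a = Some d" using dom_inside[OF r clo] by blast
    note h = head_first[OF True]
    have Td: "entry u a d" using inside_entry[OF r d] .
    have "rk a d = rk a (head u a)"
      using first_le[OF h Td] single[OF True] Td first_entry[OF h] by (simp add: gap_def entry_def)
    then have "d = head u a" using rk_inj Td first_entry[OF h] by (auto simp: entry_def)
    then show ?thesis using d True by (simp add: q_def)
  next
    case False
    then show ?thesis using dom_inside[OF r clo] by (auto simp: q_def)
  qed
  then have "r = q" by blast
  with r show q: "stable q" by simp
  have "happy v q \<subseteq> duo v - R"
  proof
    fix a assume "a \<in> happy v q"
    then have a: "a \<in> supp v" "a \<in> duo v" "v a = Suc (rk a (head v a))" "head u a = head v a"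
      using V by (auto simp: happy_def duo_def q_def)
    have "u a \<le> rk a (head v a)" using single[of a] a V by (simp add: gap_def)
    then have "u a \<noteq> v a" using a(3) by simp
    then show "a \<in> duo v - R" using Rv a(2) by blast
  qed
  then have "card (happy v q) \<le> card (duo v - R)"
    using finite_duo by (intro card_mono) auto
  also have "\<dots> \<le> 2 * card (happy v p - R)" using pay[OF p] .
  also have "\<dots> \<le> 2 * card (happy v p)"
    using finite_duo by (intro mult_le_mono2 card_mono) (auto simp: happy_def)
  finally have "card (happy v q) \<le> 2 * card (happy v p)" .
  \<comment> \<open>With \<open>K\<close> the sum of the \<open>floor_cost\<close>, the claim is
    \<open>7 w' \<le> 2 K + 9 w\<close>. Now \<open>K \<ge> 2 w'\<close> for the output
    \<open>q\<close> supplies \<open>4 w'\<close>, and the remaining \<open>3 w'\<close> are covered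
    by \<open>w' \<le> 2 w\<close>.\<close>
  then show "7 * total v q \<le> 9 * total v p"
    using total_eq[OF base v3 p] total_eq[OF base v3 q] floor_cost_ge[OF base q] by linarith
qed

end

section \<open>Running programs\<close>

definition Run :: "com \<Rightarrow> state \<Rightarrow> nat \<Rightarrow> (state \<Rightarrow> bool) \<Rightarrow> bool" where
  "Run c s t Q \<longleftrightarrow> (\<exists>t' s'. exec c s t' s' \<and> t' \<le> t \<and> Q s')"

lemma Run_mono: "Run c s t Q \<Longrightarrow> t \<le> t' \<Longrightarrow> (\<And>s'. Q s' \<Longrightarrow> Q' s') \<Longrightarrow> Run c s t' Q'"
  unfolding Run_def by (meson order_trans)

lemma Run_Seq:
  assumes "Run c s t Q" "\<And>s'. Q s' \<Longrightarrow> Run d s' u R"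
  shows "Run (Seq c d) s (t + u) R"
  using assms unfolding Run_def by (meson Seq add_mono)

lemma Run_Cond:
  assumes "bval b s \<Longrightarrow> Run c s t Q" "\<not> bval b s \<Longrightarrow> Run d s t Q"
  shows "Run (Cond b c d) s (Suc t) Q"
proof (cases "bval b s")
  case True
  then obtain t' s' where "exec c s t' s'" "t' \<le> t" "Q s'" using assms unfolding Run_def by blast
  then show ?thesis
    using CondTrue[OF True] unfolding Run_def by (intro exI[of _ "1 + t'"] exI[of _ s']) auto
next
  case False
  then obtain t' s' where "exec d s t' s'" "t' \<le> t" "Q s'" using assms unfolding Run_def by blast
  then show ?thesis
    using CondFalse[OF False] unfolding Run_def by (intro exI[of _ "1 + t'"] exI[of _ s']) auto
qed

text \<open>Loop-free code is run by evaluation: \<open>ev\<close> gives its final state and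
  \<open>len\<close> a bound on its time. Their values at \<open>While\<close> are dummies guarded
  by \<open>straight\<close>.\<close>

primrec straight :: "com \<Rightarrow> bool" where
  "straight Skip = True"
| "straight (Assign x a) = True"
| "straight (Store r i a) = True"
| "straight (Seq c d) = (straight c \<and> straight d)"
| "straight (Cond b c d) = (straight c \<and> straight d)"
| "straight (While b c) = False"

primrec ev :: "com \<Rightarrow> state \<Rightarrow> state" where
  "ev Skip s = s"
| "ev (Assign x a) s = set_reg x (aval a s) s"
| "ev (Store r i a) s = set_cell r (aval i s) (aval a s) s"
| "ev (Seq c d) s = ev d (ev c s)"
| "ev (Cond b c d) s = (if bval b s then ev c s else ev d s)"
| "ev (While b c) s = s"

primrec len :: "com \<Rightarrow> nat" where
  "len Skip = 1"
| "len (Assign x a) = 1"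
| "len (Store r i a) = 1"
| "len (Seq c d) = len c + len d"
| "len (Cond b c d) = 1 + max (len c) (len d)"
| "len (While b c) = 0"

lemma exec_straight: "straight c \<Longrightarrow> Run c s (len c) (\<lambda>s'. s' = ev c s)"
proof (induction c arbitrary: s)
  case (Seq c d)
  then show ?case using Run_Seq by fastforce
next
  case (Cond b c d)
  have "Run (Cond b c d) s (Suc (max (len c) (len d))) (\<lambda>s'. s' = ev (Cond b c d) s)"
    by (rule Run_Cond; rule Run_mono[OF Cond.IH(1)] Run_mono[OF Cond.IH(2)])
      (use Cond.prems in auto)
  then show ?case by simp
qed (auto simp: Run_def intro: exec.intros)

lemma Run_straight: "straight c \<Longrightarrow> len c \<le> t \<Longrightarrow> Q (ev c s) \<Longrightarrow> Run c s t Q"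
  by (rule Run_mono[OF exec_straight]) auto

definition For :: "nat \<Rightarrow> nat \<Rightarrow> com \<Rightarrow> com" where
  "For x y c = Seq (Assign x (Const 0))
     (While (Less (Reg x) (Reg y)) (Seq c (Assign x (Add (Reg x) (Const 1)))))"

text \<open>A round costs the body, the test and the increment; the additional 2 steps are the
  initial assignment and the final failing test. The invariant refers to the state after the counter
  has been updated.\<close>

lemma Run_For:
  assumes init: "I 0 (set_reg x 0 s)"
    and bound: "\<And>i s. I i s \<Longrightarrow> regs s x = i \<Longrightarrow> regs s y = N"
    and body: "\<And>i s. i < N \<Longrightarrow> I i s \<Longrightarrow> regs s x = i \<Longrightarrow>
      Run c s t (\<lambda>s'. regs s' x = i \<and> I (Suc i) (set_reg x (Suc i) s'))"
  shows "Run (For x y c) s (N * (t + 2) + 2) (\<lambda>s'. I N s' \<and> regs s' x = N)"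
proof -
  let ?w = "While (Less (Reg x) (Reg y)) (Seq c (Assign x (Add (Reg x) (Const 1))))"
  have loop: "Run ?w s ((N - i) * (t + 2) + 1) (\<lambda>s'. I N s' \<and> regs s' x = N)"
    if "I i s" "regs s x = i" "i \<le> N" for i s
    using that
  proof (induction "N - i" arbitrary: i s)
    case 0
    then have "\<not> bval (Less (Reg x) (Reg y)) s" using bound by auto
    then have "exec ?w s 1 s" by (rule WhileFalse)
    then show ?case using 0 unfolding Run_def by (intro exI[of _ 1] exI[of _ s]) auto
  next
    case (Suc k)
    then have i: "i < N" "N - i = Suc (N - Suc i)" "k = N - Suc i" by auto
    have b: "bval (Less (Reg x) (Reg y)) s" using bound Suc.prems i by auto
    obtain t1 s1 where 1: "exec c s t1 s1" "t1 \<le> t" "regs s1 x = i"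
      "I (Suc i) (set_reg x (Suc i) s1)"
      using body[OF i(1) Suc.prems(1,2)] unfolding Run_def by blast
    have "aval (Add (Reg x) (Const 1)) s1 = Suc i" using 1 by simp
    then have e: "exec (Seq c (Assign x (Add (Reg x) (Const 1)))) s (t1 + 1) (set_reg x (Suc i) s1)"
      by (metis exec.Assign exec.Seq 1(1))
    have "Run ?w (set_reg x (Suc i) s1) ((N - Suc i) * (t + 2) + 1) (\<lambda>s'. I N s' \<and> regs s' x = N)"
      using i 1(4) by (intro Suc.hyps(1)) (auto simp: set_reg_def)
    then obtain t2 s2 where 2: "exec ?w (set_reg x (Suc i) s1) t2 s2"
      "t2 \<le> (N - Suc i) * (t + 2) + 1" "I N s2 \<and> regs s2 x = N" unfolding Run_def by blast
    have "exec ?w s (1 + (t1 + 1) + t2) s2" using WhileTrue[OF b e 2(1)] .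
    moreover have "1 + (t1 + 1) + t2 \<le> (N - i) * (t + 2) + 1"
      using 1(2) 2(2) unfolding i(2) by simp
    ultimately show ?case using 2(3) unfolding Run_def by blast
  qed
  have "Run (Assign x (Const 0)) s 1 (\<lambda>s'. s' = set_reg x 0 s)"
    by (rule Run_straight) auto
  then have "Run (For x y c) s (1 + (N * (t + 2) + 1)) (\<lambda>s'. I N s' \<and> regs s' x = N)"
    unfolding For_def
  proof (rule Run_Seq)
    fix s' assume "s' = set_reg x 0 s"
    then show "Run ?w s' (N * (t + 2) + 1) (\<lambda>s'. I N s' \<and> regs s' x = N)"
      using loop[of 0 s'] init by (simp add: set_reg_def)
  qed
  then show ?thesis by simp
qed

text \<open>A frame condition: only the registers in \<open>X\<close> and the arrays in
  \<open>Y\<close> may have changed.\<close>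

definition agree :: "nat set \<Rightarrow> nat set \<Rightarrow> state \<Rightarrow> state \<Rightarrow> bool" where
  "agree X Y s s' \<longleftrightarrow> (\<forall>x. x \<notin> X \<longrightarrow> regs s' x = regs s x) \<and> (\<forall>r. r \<notin> Y \<longrightarrow> arrays s' r = arrays s r)"

lemma regs_set_reg [simp]: "regs (set_reg x v s) = (regs s)(x := v)"
  and arrays_set_reg [simp]: "arrays (set_reg x v s) = arrays s"
  and regs_set_cell [simp]: "regs (set_cell r i v s) = regs s"
  and arrays_set_cell [simp]: "arrays (set_cell r i v s) = (arrays s)(r := (arrays s r)(i := v))"
  by (simp_all add: set_reg_def set_cell_def)

lemma agree_trans: "agree X Y s s' \<Longrightarrow> agree X' Y' s' s'' \<Longrightarrow> X \<subseteq> Z \<Longrightarrow> X' \<subseteq> Z \<Longrightarrow> Y \<subseteq> W \<Longrightarrow> Y' \<subseteq> W \<Longrightarrow>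
   agree Z W s s''"
  unfolding agree_def by (metis subsetD)

section \<open>The algorithm\<close>

text \<open>Register 2 holds the number \<open>n\<close> of agents and register 3 the number \<open>3n + 1\<close> of sweeps.
  The \<open>k\<close>-th choice of agent \<open>a\<close> is in cell \<open>a\<close> of array \<open>1 + k\<close>, shifted by one, and the rank
  of \<open>a\<close> for that choice in cell \<open>a\<close> of array \<open>4 + k\<close>. Registers 10 to 12 receive the rank, the
  name and the opinion of the first entry of a list in the table. Array 8 is the current table, arrays
  9 and 10 are the tables of the two branches. Array 11 is positive for the agents with an entry in the
  table after the first phase, and array 12 is 1 for the agents that may still be charged.\<close>

definition alive :: "nat \<Rightarrow> nat \<Rightarrow> nat \<Rightarrow> bexp" where
  "alive r x k = Conj (Less (Const 0) (Cell (1 + k) (Reg x)))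
     (Conj (Neg (Less (Cell r (Reg x)) (Const k)))
       (Neg (Less (Cell r (Sub (Cell (1 + k) (Reg x)) (Const 1))) (Cell (4 + k) (Reg x)))))"

definition found :: "nat \<Rightarrow> nat \<Rightarrow> com" where
  "found x k = Seq (Assign 10 (Const k))
     (Seq (Assign 11 (Sub (Cell (1 + k) (Reg x)) (Const 1))) (Assign 12 (Cell (4 + k) (Reg x))))"

definition look :: "nat \<Rightarrow> nat \<Rightarrow> com" where
  "look r x = Cond (alive r x 1) (found x 1) (Cond (alive r x 2) (found x 2)
     (Cond (alive r x 3) (found x 3) (Assign 10 (Const 0))))"

definition sweep_com :: "nat \<Rightarrow> com" where
  "sweep_com r = For 5 2 (Seq (look r 5)
     (Cond (Conj (Less (Const 0) (Reg 10)) (Less (Reg 12) (Cell r (Reg 11))))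
       (Store r (Reg 11) (Reg 12)) Skip))"

definition reduce_com :: "nat \<Rightarrow> com" where
  "reduce_com r = For 6 3 (sweep_com r)"

definition fill_com :: com where
  "fill_com = For 7 2 (Store 8 (Reg 7) (Const 3))"

definition classify_com :: com where
  "classify_com = For 7 2 (Seq (look 8 7) (Seq (Store 11 (Reg 7) (Reg 10))
     (Cond (Conj (Less (Const 0) (Reg 10)) (Equal (Cell 8 (Reg 7)) (Add (Reg 10) (Const 1))))
       (Store 12 (Reg 7) (Const 1)) Skip)))"

definition copy_com :: com where
  "copy_com = For 7 2 (Seq (Store 9 (Reg 7) (Cell 8 (Reg 7))) (Store 10 (Reg 7) (Cell 8 (Reg 7))))"

definition price_com :: "nat \<Rightarrow> nat \<Rightarrow> com" where
  "price_com w c = Seq (Assign c (Const 0)) (For 7 2 (Seq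
     (Cond (Conj (Equal (Cell 12 (Reg 7)) (Const 1)) (Less (Cell w (Reg 7)) (Cell 8 (Reg 7))))
       (Assign c (Add (Reg c) (Const 1))) Skip)
     (Seq (look w 7)
       (Cond (Conj (Less (Const 0) (Cell 11 (Reg 7))) (Equal (Reg 10) (Const 0)))
         (Assign c (Add (Reg c) (Add (Reg 2) (Const 1)))) Skip))))"

text \<open>Register \<open>c\<close> enters with the price of the winner \<open>w\<close> and
  serves as a budget for charging agents lowered only by the loser \<open>l\<close>. Array 8 is
  overwritten on the fly; each round compares its own cell before replacing it.\<close>

definition commit_com :: "nat \<Rightarrow> nat \<Rightarrow> nat \<Rightarrow> com" where
  "commit_com w l c = For 7 2 (Seq
     (Cond (Conj (Equal (Cell 12 (Reg 7)) (Const 1)) (Less (Cell w (Reg 7)) (Cell 8 (Reg 7))))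
       (Store 12 (Reg 7) (Const 0))
       (Cond (Conj (Equal (Cell 12 (Reg 7)) (Const 1))
            (Conj (Less (Cell l (Reg 7)) (Cell 8 (Reg 7))) (Less (Const 0) (Reg c))))
         (Seq (Store 12 (Reg 7) (Const 0)) (Assign c (Sub (Reg c) (Const 1)))) Skip))
     (Store 8 (Reg 7) (Cell w (Reg 7))))"

text \<open>Register 11 still contains the first entry of the agent in register 4, as found by the
  preceding \<open>look\<close>.\<close>

definition branch_com :: com where
  "branch_com = Seq copy_com (Seq (Store 9 (Reg 11) (Sub (Cell 9 (Reg 11)) (Const 1)))
     (Seq (Store 10 (Reg 4) (Sub (Cell 10 (Reg 4)) (Const 1)))
     (Seq (reduce_com 9) (Seq (reduce_com 10) (Seq (price_com 9 14) (Seq (price_com 10 15)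
       (Cond (Less (Reg 15) (Reg 14)) (commit_com 10 9 15) (commit_com 9 10 14))))))))"

definition settle_com :: com where
  "settle_com = Seq (look 8 4)
     (Cond (Conj (Less (Const 0) (Reg 10)) (Less (Reg 10) (Cell 8 (Reg 4)))) branch_com Skip)"

text \<open>Two rounds per agent suffice: ranks lie between 1 and 3, so the gap is at most 2, and
  each round that finds it positive decreases it.\<close>

definition main_com :: com where
  "main_com = For 4 2 (Seq settle_com settle_com)"

definition output_com :: com where
  "output_com = Seq (For 4 2 (Seq (look 8 4)
     (Cond (Equal (Reg 10) (Const 0)) (Store 1 (Reg 4) (Const 0)) (Store 1 (Reg 4) (Add (Reg 11) (Const 1))))))
     (Assign 1 (Reg 2))"

lemma straight_look [simp]: "straight (look r x)" "len (look r x) = 6"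
  by (simp_all add: look_def found_def)

lemma ev_found:
  assumes "x \<notin> {10, 11, 12}"
  shows "regs (ev (found x k) s) =
      (regs s)(10 := k, 11 := arrays s (1 + k) (regs s x) - 1, 12 := arrays s (4 + k) (regs s x))"
    "arrays (ev (found x k) s) = arrays s"
  using assms by (simp_all add: found_def)

context roommates
begin

section \<open>Looking up first entries and closing tables on the machine\<close>

definition choice :: "nat \<Rightarrow> nat \<Rightarrow> nat" where
  "choice k a = (if \<exists>b. E a b \<and> rk a b = k then Suc (THE b. E a b \<and> rk a b = k) else 0)"

definition loaded :: "state \<Rightarrow> bool" where
  "loaded s \<longleftrightarrow> regs s 2 = n \<and> regs s 3 = Suc (3 * n) \<and>
     (\<forall>a<n. \<forall>k\<in>{1,2,3}. arrays s (1 + k) a = choice k a \<and>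
        (\<forall>b. E a b \<and> rk a b = k \<longrightarrow> arrays s (4 + k) a = rk b a))"

lemma choice_eq: "E a b \<Longrightarrow> choice (rk a b) a = Suc b"
  unfolding choice_def using rk_inj by (auto intro!: the_equality)

lemma choice_pos: "choice k a = Suc b \<Longrightarrow> E a b \<and> rk a b = k"
  using choice_eq unfolding choice_def by (auto split: if_splits) (metis choice_def choice_eq nat.inject)+

lemma choice_0: "choice k a = 0 \<longleftrightarrow> (\<forall>b. E a b \<longrightarrow> rk a b \<noteq> k)"
  by (auto simp: choice_def)

lemma loaded_agree:
  assumes "loaded s" "agree X Y s s'" "2 \<notin> X" "3 \<notin> X" "Y \<inter> {2..7} = {}"
  shows "loaded s'"
proof -
  have "arrays s' r = arrays s r" if "r \<in> {2..7}" for r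
    using assms(2,5) that by (auto simp: agree_def)
  then show ?thesis using assms(1-4) by (simp add: loaded_def agree_def)
qed

lemma bval_alive:
  assumes "loaded s" "regs s x < n" "k \<in> {1,2,3}"
  shows "bval (alive r x k) s \<longleftrightarrow> (\<exists>b. entry (arrays s r) (regs s x) b \<and> rk (regs s x) b = k)"
proof -
  define a where "a = regs s x"
  have nbk: "arrays s (Suc k) a = choice k a"
    and rv: "\<And>b. E a b \<Longrightarrow> rk a b = k \<Longrightarrow> arrays s (4 + k) a = rk b a"
    using assms unfolding loaded_def a_def by auto
  show ?thesis
  proof (cases "choice k a")
    case 0
    then have "\<forall>b. E a b \<longrightarrow> rk a b \<noteq> k" using choice_0 by blast
    then show ?thesis using nbk 0 by (auto simp: alive_def a_def[symmetric] entry_def)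
  next
    case (Suc b)
    then have b: "E a b" "rk a b = k" using choice_pos by auto
    have "(\<exists>c. entry (arrays s r) a c \<and> rk a c = k) \<longleftrightarrow> entry (arrays s r) a b"
      using b rk_inj by (auto simp: entry_def)
    then show ?thesis
      using b rv[OF b] Suc nbk by (auto simp: alive_def a_def[symmetric] entry_def not_less)
  qed
qed

lemma ev_look:
  fixes r x :: nat and s :: state
  assumes "loaded s" "regs s x = a" "a < n" "x \<notin> {10, 11, 12}"
  defines "s' \<equiv> ev (look r x) s" and "u \<equiv> arrays s r"
  shows "agree {10, 11, 12} {} s s'"
    and "regs s' 10 = (if a \<in> supp u then rk a (head u a) else 0)"
    and "a \<in> supp u \<Longrightarrow> regs s' 11 = head u a"
    and "a \<in> supp u \<Longrightarrow> regs s' 12 = rk (head u a) a"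
proof -
  define k where "k = (if a \<in> supp u then rk a (head u a) else 0)"
  have al: "bval (alive r x j) s \<longleftrightarrow> (\<exists>b. entry u a b \<and> rk a b = j)" if "j \<in> {1,2,3}" for j
    using bval_alive[OF assms(1) _ that] assms(2,3) by (simp add: u_def)
  have eq: "s' = (if a \<in> supp u then ev (found x k) s else set_reg 10 0 s)"
  proof (cases "a \<in> supp u")
    case False
    then show ?thesis
      using al[of 1] al[of 2] al[of 3] by (auto simp: s'_def look_def supp_def)
  next
    case True
    note h = head_first[OF True]
    have Th: "entry u a (head u a)" using h by (rule first_entry)
    have k: "k = rk a (head u a)" using True by (simp add: k_def)
    have "k \<le> 3" "0 < k" using Th rk_le rk_pos unfolding k by (auto simp: entry_def)
    then have k3: "k \<in> {1, 2, 3}" by auto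
    have hit: "bval (alive r x k) s" using al[OF k3] Th k by blast
    have miss: "\<not> bval (alive r x j) s" if "j \<in> {1,2,3}" "j < k" for j
      using al[OF that(1)] that(2) first_le[OF h] unfolding k by (meson leD)
    consider "k = 1" | "k = 2" | "k = 3" using k3 by blast
    then have "s' = ev (found x k) s"
    proof cases
      case 1
      then show ?thesis using hit by (simp add: s'_def look_def)
    next
      case 2
      then show ?thesis using hit miss[of 1] by (simp add: s'_def look_def)
    next
      case 3
      then show ?thesis using hit miss[of 1] miss[of 2] by (simp add: s'_def look_def)
    qed
    then show ?thesis using True by simp
  qed
  have "regs s' 10 = k \<and> (\<forall>x. x \<notin> {10, 11, 12} \<longrightarrow> regs s' x = regs s x) \<and> arrays s' = arrays s \<and>
    (a \<in> supp u \<longrightarrow> regs s' 11 = arrays s (1 + k) a - 1 \<and> regs s' 12 = arrays s (4 + k) a)"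
  proof (cases "a \<in> supp u")
    case True
    then have "s' = ev (found x k) s" using eq by simp
    then show ?thesis using ev_found[OF assms(4), of k s] assms(2) by simp
  next
    case False
    then have "s' = set_reg 10 0 s" "k = 0" using eq by (simp_all add: k_def)
    then show ?thesis using False by simp
  qed
  note facts = this
  show "agree {10, 11, 12} {} s s'" using facts by (auto simp: agree_def)
  show "regs s' 10 = (if a \<in> supp u then rk a (head u a) else 0)" using facts by (simp add: k_def)
  assume a: "a \<in> supp u"
  have Eh: "E a (head u a)" using first_entry[OF head_first[OF a]] by (simp add: entry_def)
  have k: "k = rk a (head u a)" using a by (simp add: k_def)
  have "k \<le> 3" "0 < k" using Eh rk_le rk_pos unfolding k by auto
  then have "k \<in> {1, 2, 3}" by auto
  then have "arrays s (1 + k) a = choice k a" and rv: "arrays s (4 + k) a = rk (head u a) a"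
    using assms(1,3) Eh k[symmetric] unfolding loaded_def by blast+
  then have "arrays s (1 + k) a = Suc (head u a)" using choice_eq[OF Eh] k by metis
  moreover have "regs s' 11 = arrays s (1 + k) a - 1" "regs s' 12 = arrays s (4 + k) a"
    using facts a by blast+
  ultimately show "regs s' 11 = head u a" "regs s' 12 = rk (head u a) a"
    using rv by simp_all
qed

lemma Run_sweep:
  assumes s: "loaded s" and r: "r \<notin> {2..7}"
  shows "Run (sweep_com r) s (n * 10 + 2)
    (\<lambda>s'. agree {5, 10, 11, 12} {r} s s' \<and> arrays s' r = sweep (arrays s r))"
proof -
  define I where "I i s' \<longleftrightarrow> agree {5, 10, 11, 12} {r} s s' \<and>
    arrays s' r = fold step [0..<i] (arrays s r)" for i s'
  have "Run (sweep_com r) s (n * (8 + 2) + 2) (\<lambda>s'. I n s' \<and> regs s' 5 = n)"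
    unfolding sweep_com_def
  proof (rule Run_For[where I = I])
    show "I 0 (set_reg 5 0 s)" by (simp add: I_def agree_def)
  next
    fix i s' assume "I i s'"
    then show "regs s' 2 = n" using s by (simp add: I_def agree_def loaded_def)
  next
    fix i s1 assume i: "i < n" "I i s1" "regs s1 5 = i"
    have s1: "loaded s1" "agree {5, 10, 11, 12} {r} s s1"
      using i(2) r loaded_agree[OF s] by (auto simp: I_def)
    define u where "u = arrays s1 r"
    define s2 where "s2 = ev (look r 5) s1"
    have s2: "agree {10, 11, 12} {} s1 s2"
      "regs s2 10 = (if i \<in> supp u then rk i (head u i) else 0)"
      "i \<in> supp u \<Longrightarrow> regs s2 11 = head u i"
      "i \<in> supp u \<Longrightarrow> regs s2 12 = rk (head u i) i"
      using ev_look[OF s1(1) i(3) i(1), of r] by (simp_all add: u_def s2_def)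
    have "i \<in> supp u \<Longrightarrow> 0 < rk i (head u i)" using first_entry[OF head_first] rk_pos by (auto simp: entry_def)
    then have "arrays (ev (Cond (Conj (Less (Const 0) (Reg 10)) (Less (Reg 12) (Cell r (Reg 11))))
       (Store r (Reg 11) (Reg 12)) Skip) s2) r = step i u"
      using s2 by (auto simp: step_def agree_def u_def[symmetric] min_def)
    then have "I (Suc i) (set_reg 5 (Suc i) (ev (Cond (Conj (Less (Const 0) (Reg 10)) (Less (Reg 12) (Cell r (Reg 11))))
       (Store r (Reg 11) (Reg 12)) Skip) s2))"
      using i(2) s1(2) s2(1) unfolding I_def by (auto simp: agree_def u_def)
    moreover have "regs s2 5 = i" using s2(1) i(3) by (simp add: agree_def)
    ultimately show "Run (Seq (look r 5)
     (Cond (Conj (Less (Const 0) (Reg 10)) (Less (Reg 12) (Cell r (Reg 11))))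
       (Store r (Reg 11) (Reg 12)) Skip)) s1 8
          (\<lambda>s'. regs s' 5 = i \<and> I (Suc i) (set_reg 5 (Suc i) s'))"
      by (intro Run_straight) (simp_all add: s2_def[symmetric])
  qed
  then show ?thesis
    by (rule Run_mono) (auto simp: I_def sweep_def)
qed

lemma Run_reduce:
  assumes s: "loaded s" and r: "r \<notin> {2..7}"
  shows "Run (reduce_com r) s (Suc (3 * n) * (n * 10 + 4) + 2)
    (\<lambda>s'. agree {5, 6, 10, 11, 12} {r} s s' \<and> arrays s' r = reduce (arrays s r))"
proof -
  define I where "I i s' \<longleftrightarrow> agree {5, 6, 10, 11, 12} {r} s s' \<and>
    arrays s' r = (sweep ^^ i) (arrays s r)" for i s'
  have "Run (reduce_com r) s (Suc (3 * n) * ((n * 10 + 2) + 2) + 2)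
      (\<lambda>s'. I (Suc (3 * n)) s' \<and> regs s' 6 = Suc (3 * n))"
    unfolding reduce_com_def
  proof (rule Run_For[where I = I])
    show "I 0 (set_reg 6 0 s)" by (simp add: I_def agree_def)
  next
    fix i s' assume "I i s'"
    then show "regs s' 3 = Suc (3 * n)" using s by (simp add: I_def agree_def loaded_def)
  next
    fix i s1 assume i: "I i s1" "regs s1 6 = i"
    have s1: "loaded s1"
      using i(1) r loaded_agree[OF s] by (auto simp: I_def)
    show "Run (sweep_com r) s1 (n * 10 + 2)
        (\<lambda>s'. regs s' 6 = i \<and> I (Suc i) (set_reg 6 (Suc i) s'))"
      by (rule Run_mono[OF Run_sweep[OF s1 r]]) (use i in \<open>auto simp: I_def agree_def\<close>)
  qed
  then show ?thesis
    by (rule Run_mono) (auto simp: I_def reduce_def algebra_simps)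
qed

end

section \<open>Pricing and committing a branch on the machine\<close>

lemma card_below_Suc:
  "card {i. i < Suc j \<and> P i} = card {i. i < j \<and> P i} + (if P j then 1 else 0)"
proof -
  have "{i. i < Suc j \<and> P i} = {i. i < j \<and> P i} \<union> (if P j then {j} else {})"
    by (auto simp: less_Suc_eq)
  then show ?thesis by simp
qed

context roommates
begin

definition unpaid :: "state \<Rightarrow> nat set" where
  "unpaid s = {i. i < n \<and> arrays s 12 i = 1}"

lemma unpaid_set_reg [simp]: "unpaid (set_reg x k s) = unpaid s"
  by (simp add: unpaid_def)

lemma reduce_outside: "n \<le> c \<Longrightarrow> reduce u c = u c"
proof -
  assume c: "n \<le> c"
  have "(sweep ^^ k) u c = u c" for k
    by (induction k) (simp_all add: sweep_def fold_step_outside[OF c])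
  then show ?thesis by (simp only: reduce_def)
qed

lemma Run_price:
  assumes s: "loaded s" and c: "c \<notin> {2, 3, 7, 10, 11, 12}"
    and marks: "\<And>a. a < n \<Longrightarrow> 0 < arrays s 11 a \<longleftrightarrow> a \<in> supp v"
  shows "Run (price_com w c) s (n * 12 + 3) (\<lambda>s'. agree {7, 10, 11, 12, c} {} s s' \<and>
    regs s' c = price v (arrays s 8) (unpaid s) (arrays s w))"
proof -
  define gain where "gain i \<longleftrightarrow> arrays s 12 i = 1 \<and> arrays s w i < arrays s 8 i" for i
  define lost where "lost i \<longleftrightarrow> i \<in> supp v \<and> i \<notin> supp (arrays s w)" for i
  define I where "I i s' \<longleftrightarrow> agree {7, 10, 11, 12, c} {} s s' \<and>
    regs s' c = card {j. j < i \<and> gain j} + Suc n * card {j. j < i \<and> lost j}" for i s'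
  let ?c1 = "Cond (Conj (Equal (Cell 12 (Reg 7)) (Const 1)) (Less (Cell w (Reg 7)) (Cell 8 (Reg 7))))
       (Assign c (Add (Reg c) (Const 1))) Skip"
  let ?c2 = "Cond (Conj (Less (Const 0) (Cell 11 (Reg 7))) (Equal (Reg 10) (Const 0)))
         (Assign c (Add (Reg c) (Add (Reg 2) (Const 1)))) Skip"
  have run: "Run (price_com w c) s (1 + (n * (10 + 2) + 2)) (\<lambda>s'. I n s' \<and> regs s' 7 = n)"
    unfolding price_com_def
  proof (rule Run_Seq)
    show "Run (Assign c (Const 0)) s 1 (\<lambda>s'. s' = set_reg c 0 s)"
      by (rule Run_straight) auto
  next
    fix s0 assume s0: "s0 = set_reg c 0 s"
    show "Run (For 7 2 (Seq ?c1 (Seq (look w 7) ?c2))) s0 (n * (10 + 2) + 2) (\<lambda>s'. I n s' \<and> regs s' 7 = n)"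
    proof (rule Run_For[where I = I])
      show "I 0 (set_reg 7 0 s0)" using c by (simp add: I_def agree_def s0)
    next
      fix i s' assume "I i s'"
      then show "regs s' 2 = n" using s c by (simp add: I_def agree_def loaded_def)
    next
      fix i s1 assume i: "i < n" "I i s1" "regs s1 7 = i"
      have ag1: "agree {7, 10, 11, 12, c} {} s s1" using i(2) by (simp add: I_def)
      have l1: "loaded s1" using loaded_agree[OF s ag1] c by simp
      have arr1: "arrays s1 = arrays s" using ag1 by (auto simp: agree_def)
      define s2 where "s2 = ev ?c1 s1"
      have s2: "arrays s2 = arrays s" "regs s2 = (regs s1)(c := regs s1 c + (if gain i then 1 else 0))"
        using i(3) arr1 by (simp_all add: s2_def gain_def)
      have ag2: "agree {c} {} s1 s2" using s2 arr1 by (simp add: agree_def)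
      have l2: "loaded s2" using loaded_agree[OF l1 ag2] c by simp
      have "regs s2 7 = i" using s2 c i(3) by simp
      note lk = ev_look[OF l2 this i(1), of w]
      define s3 where "s3 = ev (look w 7) s2"
      have ag3: "agree {10, 11, 12} {} s2 s3" using lk by (simp add: s3_def)
      have arr3: "arrays s3 = arrays s" using ag3 s2 by (auto simp: agree_def)
      have "0 < rk i (head (arrays s w) i)" if "i \<in> supp (arrays s w)"
        using first_entry[OF head_first[OF that]] rk_pos by (auto simp: entry_def)
      then have r10: "regs s3 10 = 0 \<longleftrightarrow> i \<notin> supp (arrays s w)"
        using lk(2) s2 by (auto simp: s3_def)
      have r3: "regs s3 7 = i" "regs s3 2 = n" "regs s3 c = regs s2 c"
        using ag3 c s2 i(3) l2 by (auto simp: agree_def loaded_def)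
      define s4 where "s4 = ev ?c2 s3"
      have s4: "arrays s4 = arrays s"
        "regs s4 = (regs s3)(c := regs s1 c + (if gain i then 1 else 0) + (if lost i then Suc n else 0))"
        using r3 arr3 r10 marks[OF i(1)] s2 by (auto simp: s4_def lost_def)
      have "I (Suc i) (set_reg 7 (Suc i) s4)"
      proof -
        have "agree {7, 10, 11, 12, c} {} s (set_reg 7 (Suc i) s4)"
          using ag1 ag3 s2 s4 by (auto simp: agree_def)
        then show ?thesis
          using i(2) s4 c unfolding I_def card_below_Suc by (simp add: algebra_simps)
      qed
      moreover have "regs s4 7 = i" using s4 r3 c by simp
      ultimately show "Run (Seq ?c1 (Seq (look w 7) ?c2)) s1 10
          (\<lambda>s'. regs s' 7 = i \<and> I (Suc i) (set_reg 7 (Suc i) s'))"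
        by (intro Run_straight)
          (simp_all only: ev.simps(4) s2_def[symmetric] s3_def[symmetric] s4_def[symmetric], simp_all)
    qed
  qed
  have "card {j. j < n \<and> gain j} + Suc n * card {j. j < n \<and> lost j} =
      price v (arrays s 8) (unpaid s) (arrays s w)"
  proof -
    have "{j. j < n \<and> gain j} = {i \<in> unpaid s. arrays s w i < arrays s 8 i}"
      by (auto simp: gain_def unpaid_def)
    moreover have "{j. j < n \<and> lost j} = supp v - supp (arrays s w)"
      using supp_less by (auto simp: lost_def)
    ultimately show ?thesis by (simp add: price_def)
  qed
  then show ?thesis by (intro Run_mono[OF run]) (auto simp: I_def)
qed

text \<open>\<open>X\<close> consists of the agents charged on behalf of the rejected table only.
  The final alternative, budget exhausted or no candidate left, is what yields the last premise of
  \<open>invar_commit\<close>.\<close>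

lemma Run_commit:
  assumes s: "loaded s" and c: "c \<notin> {2, 3, 7}" and wl: "w \<in> {9, 10}" "l \<in> {9, 10}"
  shows "Run (commit_com w l c) s (n * 7 + 2) (\<lambda>s'. agree {7, c} {8, 12} s s' \<and>
    arrays s' 8 = (\<lambda>i. if i < n then arrays s w i else arrays s 8 i) \<and>
    (\<exists>X \<subseteq> {i \<in> unpaid s. arrays s l i < arrays s 8 i \<and> \<not> arrays s w i < arrays s 8 i}.
       card X \<le> regs s c \<and>
       unpaid s' = unpaid s - {i. arrays s w i < arrays s 8 i} - X \<and>
       (card X = regs s c \<or>
        X = {i \<in> unpaid s. arrays s l i < arrays s 8 i \<and> \<not> arrays s w i < arrays s 8 i})))"
    (is "Run _ _ _ ?Q")
proof -
  let ?W = "\<lambda>i. arrays s w i < arrays s 8 i"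
  let ?L = "\<lambda>i. arrays s l i < arrays s 8 i \<and> \<not> arrays s w i < arrays s 8 i"
  \<comment> \<open>Remaining budget plus \<open>card X\<close> is constant, and as long as budget
    remains no candidate has been skipped.\<close>
  define I where "I i s' \<longleftrightarrow> agree {7, c} {8, 12} s s' \<and>
    arrays s' 8 = (\<lambda>j. if j < i then arrays s w j else arrays s 8 j) \<and>
    (\<exists>X \<subseteq> {j \<in> unpaid s. j < i \<and> ?L j}.
       regs s' c + card X = regs s c \<and>
       unpaid s' = unpaid s - {j. j < i \<and> ?W j} - X \<and>
       (0 < regs s' c \<longrightarrow> X = {j \<in> unpaid s. j < i \<and> ?L j}))" for i s'
  let ?body = "Seq
     (Cond (Conj (Equal (Cell 12 (Reg 7)) (Const 1)) (Less (Cell w (Reg 7)) (Cell 8 (Reg 7))))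
       (Store 12 (Reg 7) (Const 0))
       (Cond (Conj (Equal (Cell 12 (Reg 7)) (Const 1))
            (Conj (Less (Cell l (Reg 7)) (Cell 8 (Reg 7))) (Less (Const 0) (Reg c))))
         (Seq (Store 12 (Reg 7) (Const 0)) (Assign c (Sub (Reg c) (Const 1)))) Skip))
     (Store 8 (Reg 7) (Cell w (Reg 7)))"
  have "Run (commit_com w l c) s (n * (5 + 2) + 2) (\<lambda>s'. I n s' \<and> regs s' 7 = n)"
    unfolding commit_com_def
  proof (rule Run_For[where I = I])
    show "I 0 (set_reg 7 0 s)"
      using c by (auto simp: I_def agree_def unpaid_def)
  next
    fix i s' assume "I i s'"
    then show "regs s' 2 = n" using s c by (simp add: I_def agree_def loaded_def)
  next
    fix i s1 assume i: "i < n" "I i s1" "regs s1 7 = i"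
    have ag: "agree {7, c} {8, 12} s s1" using i(2) by (simp add: I_def)
    have a8: "arrays s1 8 = (\<lambda>j. if j < i then arrays s w j else arrays s 8 j)"
      using i(2) by (simp add: I_def)
    obtain X where X: "X \<subseteq> {j \<in> unpaid s. j < i \<and> ?L j}" "regs s1 c + card X = regs s c"
       "unpaid s1 = unpaid s - {j. j < i \<and> ?W j} - X"
       "0 < regs s1 c \<longrightarrow> X = {j \<in> unpaid s. j < i \<and> ?L j}"
      using i(2) unfolding I_def by (elim conjE exE) (rule that; assumption)
    have awl: "arrays s1 w = arrays s w" "arrays s1 l = arrays s l"
      using ag wl by (auto simp: agree_def)
    have finX: "finite X" by (rule finite_subset[OF X(1)]) (auto simp: unpaid_def)
    have iX: "i \<notin> X" using X(1) by auto
    have ui: "arrays s1 12 i = 1 \<longleftrightarrow> i \<in> unpaid s"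
    proof -
      have "arrays s1 12 i = 1 \<longleftrightarrow> i \<in> unpaid s1" using i(1) by (simp add: unpaid_def)
      then show ?thesis using X(3) iX by auto
    qed
    have tests: "arrays s1 w i < arrays s1 8 i \<longleftrightarrow> ?W i" "arrays s1 l i < arrays s1 8 i \<longleftrightarrow> arrays s l i < arrays s 8 i"
      using a8 awl by simp_all
    define m where "m = (if i \<in> unpaid s \<and> ?W i then set_cell 12 i 0 s1
      else if i \<in> unpaid s \<and> ?L i \<and> 0 < regs s1 c then set_reg c (regs s1 c - 1) (set_cell 12 i 0 s1) else s1)"
    define s2 where "s2 = set_cell 8 i (arrays s w i) m"
    have "regs m 7 = i" "arrays m w = arrays s w"
      using i(3) c awl wl by (auto simp: m_def)
    moreover have "ev ?body s1 = ev (Store 8 (Reg 7) (Cell w (Reg 7))) m"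
      using tests ui i(3) c by (simp add: m_def)
    ultimately have ev: "ev ?body s1 = s2" by (simp add: s2_def)
    have r2: "regs s2 7 = i" using i(3) c by (simp add: s2_def m_def)
    have agm: "agree {7, c} {8, 12} s m" using ag by (auto simp: m_def agree_def)
    then have ag': "agree {7, c} {8, 12} s (set_reg 7 (Suc i) s2)"
      by (simp add: agree_def s2_def)
    have "arrays m 8 = arrays s1 8" by (simp add: m_def)
    then have a8': "arrays s2 8 = (\<lambda>j. if j < Suc i then arrays s w j else arrays s 8 j)"
      using a8 by (auto simp: s2_def less_Suc_eq)
    have inst: "I (Suc i) (set_reg 7 (Suc i) s2)"
      if "Y \<subseteq> {j \<in> unpaid s. j < Suc i \<and> ?L j}" "regs s2 c + card Y = regs s c"
         "unpaid s2 = unpaid s - {j. j < Suc i \<and> ?W j} - Y"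
         "0 < regs s2 c \<longrightarrow> Y = {j \<in> unpaid s. j < Suc i \<and> ?L j}" for Y
    proof -
      have "regs (set_reg 7 (Suc i) s2) c = regs s2 c" using c by simp
      moreover have "arrays (set_reg 7 (Suc i) s2) 8 = arrays s2 8" by simp
      ultimately show ?thesis
        unfolding I_def unpaid_set_reg using ag' a8' that by (intro conjI exI[of _ Y]) simp_all
    qed
    consider (win) "i \<in> unpaid s" "?W i" | (lose) "i \<in> unpaid s" "?L i" "0 < regs s1 c"
      | (none) "i \<notin> unpaid s \<or> (\<not> ?W i \<and> \<not> (?L i \<and> 0 < regs s1 c))" by argo
    then have "I (Suc i) (set_reg 7 (Suc i) s2)"
    proof cases
      case win
      then have "regs s2 = regs s1" "arrays s2 12 = (arrays s1 12)(i := 0)"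
        by (auto simp: s2_def m_def)
      then have "unpaid s2 = unpaid s1 - {i}" "regs s2 c = regs s1 c" by (auto simp: unpaid_def)
      then have "unpaid s2 = unpaid s - {j. j < Suc i \<and> ?W j} - X"
        using X(3) win by (auto simp: less_Suc_eq)
      moreover have "{j \<in> unpaid s. j < Suc i \<and> ?L j} = {j \<in> unpaid s. j < i \<and> ?L j}"
        using win by (auto simp: less_Suc_eq)
      ultimately show ?thesis
        using X(1,2,4) \<open>regs s2 c = regs s1 c\<close> by (intro inst[of X]) simp_all
    next
      case lose
      then have "regs s2 = (regs s1)(c := regs s1 c - 1)" "arrays s2 12 = (arrays s1 12)(i := 0)"
        by (auto simp: s2_def m_def)
      then have u2: "unpaid s2 = unpaid s1 - {i}" and rc: "regs s2 c = regs s1 c - 1"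
        by (auto simp: unpaid_def)
      have "unpaid s2 = unpaid s - {j. j < Suc i \<and> ?W j} - insert i X"
        using X(3) lose u2 by (auto simp: less_Suc_eq)
      moreover have "{j \<in> unpaid s. j < Suc i \<and> ?L j} = insert i {j \<in> unpaid s. j < i \<and> ?L j}"
        using lose by (auto simp: less_Suc_eq)
      moreover have "regs s2 c + card (insert i X) = regs s c"
        using X(2) finX iX rc lose(3) by simp
      moreover have "insert i X \<subseteq> insert i {j \<in> unpaid s. j < i \<and> ?L j}" using X(1) by blast
      ultimately show ?thesis
        using X(4) lose(3) by (intro inst[of "insert i X"]) simp_all
    next
      case none
      then have "regs s2 = regs s1" "arrays s2 12 = arrays s1 12"
        by (auto simp: s2_def m_def)
      then have u2: "unpaid s2 = unpaid s1" and rc: "regs s2 c = regs s1 c" by (auto simp: unpaid_def)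
      have "unpaid s2 = unpaid s - {j. j < Suc i \<and> ?W j} - X"
        using X(3) none u2 by (auto simp: less_Suc_eq)
      moreover have "{j \<in> unpaid s. j < i \<and> ?L j} \<subseteq> {j \<in> unpaid s. j < Suc i \<and> ?L j}" by auto
      moreover have "{j \<in> unpaid s. j < Suc i \<and> ?L j} = {j \<in> unpaid s. j < i \<and> ?L j}" if "0 < regs s1 c"
        using none that by (auto simp: less_Suc_eq)
      ultimately show ?thesis
        using X(1,2,4) rc by (intro inst[of X]) (auto dest: subset_trans)
    qed
    then show "Run ?body s1 5 (\<lambda>s'. regs s' 7 = i \<and> I (Suc i) (set_reg 7 (Suc i) s'))"
      using r2 by (intro Run_straight) (simp_all only: ev, simp_all)
  qed
  then show ?thesis
  proof (rule Run_mono)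
    fix s' assume "I n s' \<and> regs s' 7 = n"
    then have I: "I n s'" by simp
    have lt: "{j \<in> unpaid s. j < n \<and> ?L j} = {j \<in> unpaid s. ?L j}"
      "unpaid s - {j. j < n \<and> ?W j} = unpaid s - {j. ?W j}"
      by (auto simp: unpaid_def)
    obtain X where X: "X \<subseteq> {j \<in> unpaid s. ?L j}" "regs s' c + card X = regs s c"
       "unpaid s' = unpaid s - {j. ?W j} - X" "0 < regs s' c \<longrightarrow> X = {j \<in> unpaid s. ?L j}"
      using I unfolding I_def lt by (elim conjE exE) (rule that; assumption)
    have "card X \<le> regs s c" "card X = regs s c \<or> X = {j \<in> unpaid s. ?L j}"
      using X(2,4) by linarith+
    moreover have "agree {7, c} {8, 12} s s'"
      "arrays s' 8 = (\<lambda>i. if i < n then arrays s w i else arrays s 8 i)"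
      using I by (simp_all add: I_def)
    ultimately show "?Q s'" using X(1,3) by blast
  qed simp
qed

end

section \<open>One complete branching\<close>

lemma Run_Store: "Run (Store r i x) s 1 (\<lambda>s'. s' = set_cell r (aval i s) (aval x s) s)"
  by (rule Run_straight) auto

context roommates
begin

text \<open>Cells from \<open>n\<close> on are kept at 0 so that arrays can be compared with tables
  as total functions; \<open>good\<close> and \<open>reduce\<close> speak about all
  arguments.\<close>

definition ready :: "(nat \<Rightarrow> nat) \<Rightarrow> state \<Rightarrow> bool" where
  "ready v s \<longleftrightarrow> loaded s \<and> (\<forall>r\<in>{8, 9, 10}. \<forall>c\<ge>n. arrays s r c = 0) \<and>
     (\<forall>a<n. 0 < arrays s 11 a \<longleftrightarrow> a \<in> supp v) \<and> invar v (arrays s 8) (unpaid s)"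

lemma Run_copy:
  assumes s: "ready v s"
  shows "Run copy_com s (n * 4 + 2) (\<lambda>s'. agree {7} {9, 10} s s' \<and>
    arrays s' 9 = arrays s 8 \<and> arrays s' 10 = arrays s 8)"
proof -
  define I where "I i s' \<longleftrightarrow> agree {7} {9, 10} s s' \<and>
    (\<forall>r\<in>{9, 10}. \<forall>c. c < i \<or> n \<le> c \<longrightarrow> arrays s' r c = arrays s 8 c)" for i s'
  have "Run copy_com s (n * (2 + 2) + 2) (\<lambda>s'. I n s' \<and> regs s' 7 = n)"
    unfolding copy_com_def
  proof (rule Run_For[where I = I])
    show "I 0 (set_reg 7 0 s)" using s by (simp add: I_def agree_def ready_def)
  next
    fix i s' assume "I i s'"
    then show "regs s' 2 = n" using s by (simp add: I_def agree_def loaded_def ready_def)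
  next
    fix i s1 assume "i < n" "I i s1" "regs s1 7 = i"
    then show "Run (Seq (Store 9 (Reg 7) (Cell 8 (Reg 7))) (Store 10 (Reg 7) (Cell 8 (Reg 7)))) s1 2
          (\<lambda>s'. regs s' 7 = i \<and> I (Suc i) (set_reg 7 (Suc i) s'))"
      by (intro Run_straight) (auto simp: I_def agree_def less_Suc_eq)
  qed
  then show ?thesis
  proof (rule Run_mono)
    fix s' assume I: "I n s' \<and> regs s' 7 = n"
    then have "arrays s' r c = arrays s 8 c" if "r \<in> {9, 10}" for r c
      using that by (cases "c < n") (auto simp: I_def)
    then show "agree {7} {9, 10} s s' \<and> arrays s' 9 = arrays s 8 \<and> arrays s' 10 = arrays s 8"
      using I by (auto simp: I_def)
  qed simp
qed

lemma drop_outside: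
  assumes "a \<in> supp u" "n \<le> c"
  shows "drop_first u a c = u c" "drop_last u a c = u c"
  using reduce_outside[OF assms(2)] head_less[OF assms(1)] supp_less[OF assms(1)] assms(2)
  by (auto simp: drop_first_def drop_last_def)

lemma closed_drop:
  assumes "\<And>c. c < n \<Longrightarrow> u c \<le> 3"
  shows "closed (drop_first u a)" "closed (drop_last u a)"
proof -
  have "(u(b := u b - 1)) c \<le> 3" if "c < n" for b c
    using assms[OF that] by (auto intro: le_diff_conv[THEN iffD2] le_SucI)
  then show "closed (drop_first u a)" "closed (drop_last u a)"
    unfolding drop_first_def drop_last_def by (blast intro: closed_reduce)+
qed

lemma ready_commit:
  assumes s: "ready v s" and w: "\<And>c. w c \<le> arrays s 8 c" "closed w" "\<And>c. n \<le> c \<Longrightarrow> w c = 0"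
    and base: "base v" and solv: "stable p0"
    and forced: "\<And>p. stable p \<Longrightarrow> forced v (arrays s 8) w p \<or> forced v (arrays s 8) l p"
    and price: "price v (arrays s 8) (unpaid s) w \<le> price v (arrays s 8) (unpaid s) l"
    and s': "loaded s'" "arrays s' 8 = w" "arrays s' 11 = arrays s 11"
      "\<And>c. n \<le> c \<Longrightarrow> arrays s' 9 c = 0 \<and> arrays s' 10 c = 0"
    and X: "X \<subseteq> {i \<in> unpaid s. l i < arrays s 8 i \<and> \<not> w i < arrays s 8 i}"
      "card X \<le> price v (arrays s 8) (unpaid s) w"
      "unpaid s' = unpaid s - {i. w i < arrays s 8 i} - X"
      "card X = price v (arrays s 8) (unpaid s) w \<or>
        X = {i \<in> unpaid s. l i < arrays s 8 i \<and> \<not> w i < arrays s 8 i}"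
  shows "ready v s'"
proof -
  define u where "u = arrays s 8"
  have inv: "invar v u (unpaid s)" using s by (simp add: ready_def u_def)
  have fin: "finite (unpaid s)" by (simp add: unpaid_def)
  have "invar v w (unpaid s')"
  proof (rule invar_commit[OF inv _ solv, of w l])
    show "forced v u w p \<or> forced v u l p" if "stable p" for p
      using forced[OF that] by (simp add: u_def)
    show "w c \<le> u c" for c using w(1) by (simp add: u_def)
    show "closed w" by (rule w(2))
    show "price v u (unpaid s) w \<le> price v u (unpaid s) l" using price by (simp add: u_def)
    show "unpaid s' \<subseteq> unpaid s" using X(3) by auto
    show "w i = u i" if "i \<in> unpaid s'" for i
      using that w(1)[of i] X(3) by (auto simp: u_def)
    have "unpaid s - unpaid s' \<subseteq> {i \<in> unpaid s. w i < u i} \<union> X"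
      using X(3) by (auto simp: u_def)
    then have "card (unpaid s - unpaid s') \<le> card ({i \<in> unpaid s. w i < u i} \<union> X)"
      using fin finite_subset[OF X(1)] by (intro card_mono) auto
    also have "\<dots> \<le> card {i \<in> unpaid s. w i < u i} + card X" by (rule card_Un_le)
    also have "card {i \<in> unpaid s. w i < u i} \<le> price v u (unpaid s) w"
      by (simp add: price_def)
    finally show "card (unpaid s - unpaid s') \<le> 2 * price v u (unpaid s) w"
      using X(2) by (simp add: u_def)
    have sub: "X \<subseteq> {i \<in> unpaid s - unpaid s'. l i < u i}" using X(1,3) by (auto simp: u_def)
    show "price v u (unpaid s) w \<le> card {i \<in> unpaid s - unpaid s'. l i < u i} \<or>
      (\<forall>i\<in>unpaid s'. \<not> l i < u i)"
    proof (cases "card X = price v u (unpaid s) w")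
      case True
      then show ?thesis using card_mono[OF _ sub] fin by simp
    next
      case False
      then have "X = {i \<in> unpaid s. l i < u i \<and> \<not> w i < u i}" using X(4) by (simp add: u_def)
      then show ?thesis using X(3) by (auto simp: u_def)
    qed
  qed
  then show ?thesis using s s' w(3) by (auto simp: ready_def)
qed

lemma Run_branch:
  assumes s: "ready v s" and a: "regs s 4 = a" "a < n" "a \<in> supp (arrays s 8)"
      "regs s 11 = head (arrays s 8) a" "rk a (head (arrays s 8) a) < arrays s 8 a"
    and base: "base v" and v3: "\<And>c. c < n \<Longrightarrow> v c \<le> 3" and solv: "stable p0"
  defines "u \<equiv> arrays s 8"
  shows "Run branch_com s (150 * (n + 1) ^ 2) (\<lambda>s'. ready v s' \<and> regs s' 4 = a \<and>
    (arrays s' 8 = drop_first u a \<or> arrays s' 8 = drop_last u a))"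
proof -
  have ld: "loaded s" and good: "good v u" and out: "\<And>c. n \<le> c \<Longrightarrow> u c = 0"
    and marks: "\<And>a. a < n \<Longrightarrow> 0 < arrays s 11 a \<longleftrightarrow> a \<in> supp v"
    using s by (auto simp: ready_def invar_def u_def)
  have u3: "u c \<le> 3" if "c < n" for c
    using good v3[OF that] unfolding good_def by (meson order_trans)
  have a_v: "a \<in> supp v" and au: "a \<in> supp u" using a(3) good by (auto simp: good_def u_def)
  define A where "A = drop_first u a"
  define B where "B = drop_last u a"
  have A: "A c \<le> u c" "closed A" "n \<le> c \<Longrightarrow> A c = 0" and
    B: "B c \<le> u c" "closed B" "n \<le> c \<Longrightarrow> B c = 0" for c
    using drop_le[of u a c] closed_drop[OF u3] drop_outside[OF au, of c] out
    by (simp_all add: A_def B_def)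
  have forced: "forced v u A p \<or> forced v u B p" if "stable p" for p
    using forced_cases[OF base v3 good a_v _ that] a(5) by (simp add: A_def B_def u_def)
  \<comment> \<open>Until the commit, only scratch registers and the two branch tables change;
    everything that \<open>ready\<close> mentions about array 8, the marks and the uncharged agents
    persists.\<close>
  define Fr where "Fr = agree {5, 6, 7, 10, 11, 12, 14, 15} {9, 10} s"
  have Fr: "loaded s'" "arrays s' 8 = u" "arrays s' 11 = arrays s 11" "unpaid s' = unpaid s"
    "regs s' 4 = a" if "Fr s'" for s'
    using that loaded_agree[OF ld, of "{5, 6, 7, 10, 11, 12, 14, 15}" "{9, 10}" s'] a(1)
    unfolding Fr_def by (auto simp: agree_def u_def unpaid_def)
  have Fr_step: "Fr s''" if "Fr s'" "agree X Y s' s''" "X \<subseteq> {5, 6, 7, 10, 11, 12, 14, 15}" "Y \<subseteq> {9, 10}"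
    for s' s'' X Y
    using that unfolding Fr_def by (meson agree_trans subset_refl)
  let ?P = "price v u (unpaid s)"
  define Q where "Q s' \<longleftrightarrow> ready v s' \<and> regs s' 4 = a \<and> (arrays s' 8 = A \<or> arrays s' 8 = B)" for s'
  have commit: "Run (commit_com w l c) s1 (n * 7 + 2) Q"
    if s1: "Fr s1" "arrays s1 9 = A" "arrays s1 10 = B" "regs s1 c = ?P W" "?P W \<le> ?P L"
      and wl: "(w = 9 \<and> l = 10 \<and> W = A \<and> L = B) \<or> (w = 10 \<and> l = 9 \<and> W = B \<and> L = A)"
      and c: "c \<in> {14, 15}" for s1 w l c W L
  proof -
    have W: "W c \<le> u c" "closed W" "n \<le> c \<Longrightarrow> W c = 0" for c
      using wl A B by auto
    have rd: "arrays s1 w = W" "arrays s1 l = L" "w \<in> {9, 10}" "l \<in> {9, 10}" using wl s1 by auto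
    have cc: "c \<notin> {2, 3, 7}" using c by auto
    show ?thesis
    proof (rule Run_mono[OF Run_commit[OF Fr(1)[OF s1(1)] cc rd(3,4)]])
      fix s2
      assume H: "agree {7, c} {8, 12} s1 s2 \<and>
        arrays s2 8 = (\<lambda>i. if i < n then arrays s1 w i else arrays s1 8 i) \<and>
        (\<exists>X \<subseteq> {i \<in> unpaid s1. arrays s1 l i < arrays s1 8 i \<and> \<not> arrays s1 w i < arrays s1 8 i}.
         card X \<le> regs s1 c \<and>
         unpaid s2 = unpaid s1 - {i. arrays s1 w i < arrays s1 8 i} - X \<and>
         (card X = regs s1 c \<or>
          X = {i \<in> unpaid s1. arrays s1 l i < arrays s1 8 i \<and> \<not> arrays s1 w i < arrays s1 8 i}))"
      have ag: "agree {7, c} {8, 12} s1 s2" using H by blast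
      have a8: "arrays s2 8 = W"
        using H W(3) out Fr(2)[OF s1(1)] rd by (auto simp: fun_eq_iff not_less)
      obtain X where X: "X \<subseteq> {i \<in> unpaid s. L i < u i \<and> \<not> W i < u i}" "card X \<le> ?P W"
        "unpaid s2 = unpaid s - {i. W i < u i} - X"
        "card X = ?P W \<or> X = {i \<in> unpaid s. L i < u i \<and> \<not> W i < u i}"
        using H unfolding Fr(2,4)[OF s1(1)] rd(1,2) s1(4)
        by (elim conjE exE) (rule that; assumption)
      have "ready v s2"
      proof (rule ready_commit[OF s _ W(2) W(3) base solv])
        show "loaded s2"
          using loaded_agree[OF Fr(1)[OF s1(1)] ag] cc by auto
        show "arrays s2 11 = arrays s 11" using ag Fr(3)[OF s1(1)] by (auto simp: agree_def)
        show "arrays s2 9 c = 0 \<and> arrays s2 10 c = 0" if "n \<le> c" for c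
          using ag s1(2,3) A(3)[OF that] B(3)[OF that] by (auto simp: agree_def)
      qed (use W(1) X s1(5) a8 forced wl in \<open>auto simp: u_def\<close>)
      moreover have "regs s2 4 = a" using ag c Fr(5)[OF s1(1)] by (auto simp: agree_def)
      ultimately show "Q s2" using a8 wl by (auto simp: Q_def)
    qed simp
  qed
  let ?R = "Suc (3 * n) * (n * 10 + 4) + 2" and ?p = "n * 12 + 3"
  \<comment> \<open>The two reductions, of about \<open>30 n^2\<close> steps each, dominate; all
    other parts are linear.\<close>
  have "Run branch_com s ((n * 4 + 2) + (1 + (1 + (?R + (?R + (?p + (?p + Suc (n * 7 + 2)))))))) Q"
    unfolding branch_com_def
  proof (rule Run_Seq[OF Run_copy[OF s]])
    fix s1 assume s1: "agree {7} {9, 10} s s1 \<and> arrays s1 9 = arrays s 8 \<and> arrays s1 10 = arrays s 8"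
    have F1: "Fr s1" using s1 unfolding Fr_def by (auto simp: agree_def)
    have r1: "regs s1 11 = head u a" "regs s1 4 = a" "arrays s1 9 = u" "arrays s1 10 = u"
      using s1 a(1,4) by (auto simp: agree_def u_def)
    show "Run (Seq (Store 9 (Reg 11) (Sub (Cell 9 (Reg 11)) (Const 1)))
     (Seq (Store 10 (Reg 4) (Sub (Cell 10 (Reg 4)) (Const 1)))
     (Seq (reduce_com 9) (Seq (reduce_com 10) (Seq (price_com 9 14) (Seq (price_com 10 15)
       (Cond (Less (Reg 15) (Reg 14)) (commit_com 10 9 15) (commit_com 9 10 14)))))))) s1
       (1 + (1 + (?R + (?R + (?p + (?p + Suc (n * 7 + 2))))))) Q"
    proof (rule Run_Seq[OF Run_Store], rule Run_Seq[OF Run_Store])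
      fix s2 s3
      assume e: "s2 = set_cell 9 (aval (Reg 11) s1) (aval (Sub (Cell 9 (Reg 11)) (Const 1)) s1) s1"
        "s3 = set_cell 10 (aval (Reg 4) s2) (aval (Sub (Cell 10 (Reg 4)) (Const 1)) s2) s2"
      have r3: "arrays s3 9 = u(head u a := u (head u a) - 1)" "arrays s3 10 = u(a := u a - 1)"
        using r1 by (simp_all add: e)
      have F3: "Fr s3" by (rule Fr_step[OF F1, of "{}" "{9, 10}"]) (auto simp: e agree_def)
      show "Run (Seq (reduce_com 9) (Seq (reduce_com 10) (Seq (price_com 9 14) (Seq (price_com 10 15)
       (Cond (Less (Reg 15) (Reg 14)) (commit_com 10 9 15) (commit_com 9 10 14)))))) s3
         (?R + (?R + (?p + (?p + Suc (n * 7 + 2))))) Q"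
      proof (rule Run_Seq[OF Run_reduce[OF Fr(1)[OF F3]]])
        fix s4 assume s4: "agree {5, 6, 10, 11, 12} {9} s3 s4 \<and> arrays s4 9 = reduce (arrays s3 9)"
        have F4: "Fr s4" by (rule Fr_step[OF F3 conjunct1[OF s4]]) auto
        have r4: "arrays s4 9 = A" "arrays s4 10 = u(a := u a - 1)"
          using s4 r3 by (auto simp: A_def drop_first_def agree_def)
        show "Run (Seq (reduce_com 10) (Seq (price_com 9 14) (Seq (price_com 10 15)
       (Cond (Less (Reg 15) (Reg 14)) (commit_com 10 9 15) (commit_com 9 10 14))))) s4
         (?R + (?p + (?p + Suc (n * 7 + 2)))) Q"
        proof (rule Run_Seq[OF Run_reduce[OF Fr(1)[OF F4]]])
          fix s5 assume s5: "agree {5, 6, 10, 11, 12} {10} s4 s5 \<and> arrays s5 10 = reduce (arrays s4 10)"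
          have F5: "Fr s5" by (rule Fr_step[OF F4 conjunct1[OF s5]]) auto
          have r5: "arrays s5 9 = A" "arrays s5 10 = B"
            using s5 r4 by (auto simp: B_def drop_last_def agree_def)
          have m5: "0 < arrays s5 11 a \<longleftrightarrow> a \<in> supp v" if "a < n" for a
            using marks[OF that] Fr(3)[OF F5] by simp
          show "Run (Seq (price_com 9 14) (Seq (price_com 10 15)
            (Cond (Less (Reg 15) (Reg 14)) (commit_com 10 9 15) (commit_com 9 10 14)))) s5
              (?p + (?p + Suc (n * 7 + 2))) Q"
          proof (rule Run_Seq[OF Run_price[OF Fr(1)[OF F5] _ m5, of 14]])
            fix s6 assume s6: "agree {7, 10, 11, 12, 14} {} s5 s6 \<and>
              regs s6 14 = price v (arrays s5 8) (unpaid s5) (arrays s5 9)"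
            have F6: "Fr s6" by (rule Fr_step[OF F5 conjunct1[OF s6]]) auto
            have r6: "arrays s6 9 = A" "arrays s6 10 = B" "regs s6 14 = ?P A"
              using s6 r5 Fr(2,4)[OF F5] by (auto simp: agree_def)
            have m6: "0 < arrays s6 11 a \<longleftrightarrow> a \<in> supp v" if "a < n" for a
              using marks[OF that] Fr(3)[OF F6] by simp
            show "Run (Seq (price_com 10 15)
              (Cond (Less (Reg 15) (Reg 14)) (commit_com 10 9 15) (commit_com 9 10 14))) s6
                (?p + Suc (n * 7 + 2)) Q"
            proof (rule Run_Seq[OF Run_price[OF Fr(1)[OF F6] _ m6, of 15]])
              fix s7 assume s7: "agree {7, 10, 11, 12, 15} {} s6 s7 \<and>
                regs s7 15 = price v (arrays s6 8) (unpaid s6) (arrays s6 10)"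
              have F7: "Fr s7" by (rule Fr_step[OF F6 conjunct1[OF s7]]) auto
              have r7: "arrays s7 9 = A" "arrays s7 10 = B" "regs s7 14 = ?P A" "regs s7 15 = ?P B"
                using s7 r6 Fr(2,4)[OF F6] by (auto simp: agree_def)
              show "Run (Cond (Less (Reg 15) (Reg 14)) (commit_com 10 9 15) (commit_com 9 10 14)) s7
                (Suc (n * 7 + 2)) Q"
              proof (rule Run_Cond)
                assume "bval (Less (Reg 15) (Reg 14)) s7"
                then show "Run (commit_com 10 9 15) s7 (n * 7 + 2) Q"
                  using r7 by (intro commit[OF F7 r7(1,2), of 15 B A]) auto
              next
                assume "\<not> bval (Less (Reg 15) (Reg 14)) s7"
                then show "Run (commit_com 9 10 14) s7 (n * 7 + 2) Q"
                  using r7 by (intro commit[OF F7 r7(1,2), of 14 A B]) auto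
              qed
            qed simp
          qed simp
        qed simp
      qed simp
    qed
  qed
  then show ?thesis
    by (rule Run_mono) (auto simp: Q_def A_def B_def power2_eq_square algebra_simps)
qed

end

section \<open>Reading the input and tabulating mutual ranks\<close>

definition put_com :: "nat \<Rightarrow> com" where
  "put_com k = Cond (Less (Const (k - 1)) (Reg 16))
     (Store (1 + k) (Reg 7) (Add (Cell 0 (Add (Reg 13) (Const k))) (Const 1))) Skip"

definition parse_com :: com where
  "parse_com = Seq (Seq (Assign 2 (Cell 0 (Const 0)))
     (Seq (Assign 3 (Add (Add (Reg 2) (Reg 2)) (Add (Reg 2) (Const 1)))) (Assign 13 (Const 1))))
     (For 7 2 (Seq (Assign 16 (Cell 0 (Reg 13))) (Seq (put_com 1) (Seq (put_com 2) (Seq (put_com 3)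
       (Assign 13 (Add (Reg 13) (Add (Reg 16) (Const 1)))))))))"

text \<open>Searches the list of the chosen agent for the current one. Adjacency is symmetric and
  lists have at most three places, so the third place needs no test.\<close>

definition rank_com :: "nat \<Rightarrow> com" where
  "rank_com k = Cond (Less (Const 0) (Cell (1 + k) (Reg 7)))
     (Cond (Equal (Cell 2 (Sub (Cell (1 + k) (Reg 7)) (Const 1))) (Add (Reg 7) (Const 1)))
       (Store (4 + k) (Reg 7) (Const 1))
       (Cond (Equal (Cell 3 (Sub (Cell (1 + k) (Reg 7)) (Const 1))) (Add (Reg 7) (Const 1)))
         (Store (4 + k) (Reg 7) (Const 2)) (Store (4 + k) (Reg 7) (Const 3)))) Skip"

definition ranks_com :: com where
  "ranks_com = For 7 2 (Seq (rank_com 1) (Seq (rank_com 2) (rank_com 3)))"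

definition roommates_com :: com where
  "roommates_com = Seq parse_com (Seq ranks_com (Seq fill_com (Seq (reduce_com 8)
     (Seq classify_com (Seq main_com output_com)))))"

lemma straight_rank [simp]: "straight (rank_com k)" "len (rank_com k) = 4"
  by (simp_all add: rank_com_def)

section \<open>Main loop, preparation and output\<close>

context roommates
begin

text \<open>When no branching takes place the gap of \<open>a\<close> is already 0, so truncated
  subtraction describes both outcomes. Gaps never grow elsewhere, hence settled agents stay
  settled.\<close>

lemma Run_settle:
  assumes s: "ready v s" and a: "regs s 4 = a" "a < n"
    and base: "base v" and v3: "\<And>c. c < n \<Longrightarrow> v c \<le> 3" and solv: "stable p0"
  defines "u \<equiv> arrays s 8"
  shows "Run settle_com s (7 + 150 * (n + 1) ^ 2) (\<lambda>s'. ready v s' \<and> regs s' 4 = a \<and>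
    (\<forall>c\<in>supp v. gap (arrays s' 8) c \<le> gap u c) \<and> (a \<in> supp v \<longrightarrow> gap (arrays s' 8) a \<le> gap u a - 1))"
    (is "Run _ _ _ ?Q")
proof -
  have ld: "loaded s" and good: "good v u" using s by (auto simp: ready_def invar_def u_def)
  have clo: "closed u" and V: "supp u = supp v" using good by (auto simp: good_def)
  have "Run settle_com s (6 + Suc (150 * (n + 1) ^ 2)) ?Q"
    unfolding settle_com_def
  proof (rule Run_Seq[OF Run_straight, where Q = "\<lambda>s'. s' = ev (look 8 4) s"])
    fix s1 assume s1: "s1 = ev (look 8 4) s"
    note lk = ev_look[OF ld a, of 8, folded s1 u_def, simplified]
    have arr: "arrays s1 = arrays s" and r4: "regs s1 4 = a" using lk(1) a by (auto simp: agree_def)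
    have rd: "ready v s1"
      using s arr loaded_agree[OF ld lk(1)] by (simp add: ready_def unpaid_def)
    show "Run (Cond (Conj (Less (Const 0) (Reg 10)) (Less (Reg 10) (Cell 8 (Reg 4)))) branch_com Skip) s1
      (Suc (150 * (n + 1) ^ 2)) ?Q"
    proof (rule Run_Cond)
      assume "bval (Conj (Less (Const 0) (Reg 10)) (Less (Reg 10) (Cell 8 (Reg 4)))) s1"
      then have H: "a \<in> supp u" "rk a (head u a) < u a"
        using lk(2) arr r4 by (auto simp: u_def split: if_splits)
      then have "0 < gap u a" by (simp add: gap_def)
      show "Run branch_com s1 (150 * (n + 1) ^ 2) ?Q"
      proof (rule Run_mono[OF Run_branch[OF rd r4 a(2) _ _ _ base v3 solv]])
        fix s' assume *: "ready v s' \<and> regs s' 4 = a \<and> (arrays s' 8 = drop_first (arrays s1 8) a \<or>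
          arrays s' 8 = drop_last (arrays s1 8) a)"
        then have Vs: "supp (arrays s' 8) = supp v" by (simp add: ready_def invar_def good_def)
        have le: "arrays s' 8 c \<le> u c" for c using * drop_le arr by (auto simp: u_def)
        have "gap (arrays s' 8) a < gap u a"
          using * arr gap_drop_first[OF clo, of a] gap_drop_last[of a u] H V Vs \<open>0 < gap u a\<close>
          by (auto simp: u_def)
        then show "?Q s'" using * gap_mono[OF le] Vs by auto
      qed (use H lk(3) arr in \<open>auto simp: u_def\<close>)
    next
      assume "\<not> bval (Conj (Less (Const 0) (Reg 10)) (Less (Reg 10) (Cell 8 (Reg 4)))) s1"
      moreover have "0 < rk a (head u a)" if "a \<in> supp u"
        using first_entry[OF head_first[OF that]] rk_pos by (auto simp: entry_def)
      ultimately have "gap u a = 0" if "a \<in> supp v"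
        using lk(2) arr r4 that V by (auto simp: u_def gap_def)
      then show "Run Skip s1 (150 * (n + 1) ^ 2) ?Q"
        using rd r4 arr by (intro Run_straight) (auto simp: u_def)
    qed
  qed simp_all
  then show ?thesis by (rule Run_mono) auto
qed

lemma ready_set_reg: "ready v s \<Longrightarrow> x \<notin> {2, 3} \<Longrightarrow> ready v (set_reg x k s)"
  using loaded_agree[of s "{x}" "{}" "set_reg x k s"]
  by (simp add: ready_def agree_def)

lemma Run_main:
  assumes s: "ready v s"
    and base: "base v" and v3: "\<And>c. c < n \<Longrightarrow> v c \<le> 3" and solv: "stable p0"
  shows "Run main_com s (n * (2 * (7 + 150 * (n + 1) ^ 2) + 2) + 2)
    (\<lambda>s'. ready v s' \<and> (\<forall>a\<in>supp v. gap (arrays s' 8) a = 0))"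
proof -
  define I where "I i s' \<longleftrightarrow> ready v s' \<and> (\<forall>a<i. a \<in> supp v \<longrightarrow> gap (arrays s' 8) a = 0)" for i s'
  let ?t = "7 + 150 * (n + 1) ^ 2"
  have "Run main_com s (n * ((?t + ?t) + 2) + 2) (\<lambda>s'. I n s' \<and> regs s' 4 = n)"
    unfolding main_com_def
  proof (rule Run_For[where I = I])
    show "I 0 (set_reg 4 0 s)" using ready_set_reg[OF s] by (simp add: I_def)
  next
    fix i s' assume "I i s'"
    then show "regs s' 2 = n" by (simp add: I_def ready_def loaded_def)
  next
    fix i s1 assume i: "i < n" "I i s1" "regs s1 4 = i"
    have rd: "ready v s1" using i(2) by (simp add: I_def)
    define u where "u = arrays s1 8"
    have gap2: "gap u i \<le> 2" if "i \<in> supp v"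
    proof -
      have good: "good v u" using rd by (simp add: ready_def invar_def u_def)
      then have iu: "i \<in> supp u" using that by (simp add: good_def)
      have "u i \<le> 3" using good v3[OF i(1)] unfolding good_def by (meson order_trans)
      moreover have "0 < rk i (head u i)"
        using first_entry[OF head_first[OF iu]] rk_pos by (auto simp: entry_def)
      ultimately show ?thesis by (simp add: gap_def)
    qed
    show "Run (Seq settle_com settle_com) s1 (?t + ?t) (\<lambda>s'. regs s' 4 = i \<and> I (Suc i) (set_reg 4 (Suc i) s'))"
    proof (rule Run_Seq[OF Run_settle[OF rd i(3) i(1) base v3 solv]])
      fix s2 assume s2: "ready v s2 \<and> regs s2 4 = i \<and>
        (\<forall>c\<in>supp v. gap (arrays s2 8) c \<le> gap (arrays s1 8) c) \<and>
        (i \<in> supp v \<longrightarrow> gap (arrays s2 8) i \<le> gap (arrays s1 8) i - 1)"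
      show "Run settle_com s2 ?t (\<lambda>s'. regs s' 4 = i \<and> I (Suc i) (set_reg 4 (Suc i) s'))"
      proof (rule Run_mono[OF Run_settle[OF _ _ i(1) base v3 solv]])
        fix s3 assume s3: "ready v s3 \<and> regs s3 4 = i \<and>
          (\<forall>c\<in>supp v. gap (arrays s3 8) c \<le> gap (arrays s2 8) c) \<and>
          (i \<in> supp v \<longrightarrow> gap (arrays s3 8) i \<le> gap (arrays s2 8) i - 1)"
        have "gap (arrays s3 8) i = 0" if "i \<in> supp v"
          using s2 s3 that gap2[OF that] by (fastforce simp: u_def)
        moreover have "gap (arrays s3 8) a = 0" if "a < i" "a \<in> supp v" for a
          using s2 s3 i(2) that unfolding I_def by (metis le_zero_eq)
        ultimately show "regs s3 4 = i \<and> I (Suc i) (set_reg 4 (Suc i) s3)"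
          using s3 ready_set_reg[of v s3 4] by (auto simp: I_def less_Suc_eq)
      qed (use s2 in auto)
    qed auto
  qed
  then show ?thesis
    by (rule Run_mono) (auto simp: I_def dest: supp_less)
qed

lemma Run_classify:
  assumes s: "loaded s" and base: "base v" and v: "arrays s 8 = v"
    and zero: "\<And>r c. r \<in> {8, 9, 10} \<Longrightarrow> n \<le> c \<Longrightarrow> arrays s r c = 0" "\<And>c. arrays s 12 c = 0"
  shows "Run classify_com s (n * 11 + 2) (\<lambda>s'. ready v s')"
proof -
  define I where "I i s' \<longleftrightarrow> agree {7, 10, 11, 12} {11, 12} s s' \<and>
    (\<forall>a<i. (0 < arrays s' 11 a \<longleftrightarrow> a \<in> supp v) \<and> (arrays s' 12 a = 1 \<longleftrightarrow> a \<in> duo v)) \<and>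
    (\<forall>a\<ge>i. arrays s' 12 a = 0)" for i s'
  let ?c = "Cond (Conj (Less (Const 0) (Reg 10)) (Equal (Cell 8 (Reg 7)) (Add (Reg 10) (Const 1))))
       (Store 12 (Reg 7) (Const 1)) Skip"
  have "Run classify_com s (n * (9 + 2) + 2) (\<lambda>s'. I n s' \<and> regs s' 7 = n)"
    unfolding classify_com_def
  proof (rule Run_For[where I = I])
    show "I 0 (set_reg 7 0 s)" using zero by (simp add: I_def agree_def)
  next
    fix i s' assume "I i s'"
    then show "regs s' 2 = n" using s by (simp add: I_def agree_def loaded_def)
  next
    fix i s1 assume i: "i < n" "I i s1" "regs s1 7 = i"
    have ag1: "agree {7, 10, 11, 12} {11, 12} s s1" using i(2) by (simp add: I_def)
    have l1: "loaded s1" using loaded_agree[OF s ag1] by simp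
    have a8: "arrays s1 8 = v" using ag1 v by (auto simp: agree_def)
    define s2 where "s2 = ev (look 8 7) s1"
    note lk = ev_look[OF l1 i(3) i(1), of 8, folded s2_def, unfolded a8, simplified]
    have arr2: "arrays s2 = arrays s1" "regs s2 7 = i" using lk(1) i(3) by (auto simp: agree_def)
    define P where "P \<longleftrightarrow> 0 < regs s2 10 \<and> v i = regs s2 10 + 1"
    define s3 where "s3 = set_cell 11 i (regs s2 10) s2"
    define s4 where "s4 = (if P then set_cell 12 i 1 s3 else s3)"
    have ev: "ev (Seq (look 8 7) (Seq (Store 11 (Reg 7) (Reg 10)) ?c)) s1 = s4"
      using arr2 a8 by (auto simp: s4_def s3_def P_def s2_def[symmetric])
    have "0 < rk i (head v i)" if "i \<in> supp v"
      using first_entry[OF head_first[OF that]] rk_pos by (auto simp: entry_def)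
    then have marks: "0 < regs s2 10 \<longleftrightarrow> i \<in> supp v" "P \<longleftrightarrow> i \<in> duo v"
      using lk(2) by (auto simp: P_def duo_def)
    have "agree {7, 10, 11, 12} {11, 12} s (set_reg 7 (Suc i) s4)"
      using ag1 lk(1) by (auto simp: agree_def s4_def s3_def)
    moreover have "arrays s4 11 = (arrays s1 11)(i := regs s2 10)"
      "arrays s4 12 = (if P then (arrays s1 12)(i := 1) else arrays s1 12)"
      using arr2 by (auto simp: s4_def s3_def)
    ultimately have "I (Suc i) (set_reg 7 (Suc i) s4)"
      using i(2) marks unfolding I_def by (auto simp: less_Suc_eq)
    moreover have "regs s4 7 = i" using arr2 by (simp add: s4_def s3_def)
    ultimately show "Run (Seq (look 8 7) (Seq (Store 11 (Reg 7) (Reg 10)) ?c)) s1 9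
      (\<lambda>s'. regs s' 7 = i \<and> I (Suc i) (set_reg 7 (Suc i) s'))"
      by (intro Run_straight) (simp_all only: ev, simp_all)
  qed
  then show ?thesis
  proof (rule Run_mono)
    fix s' assume "I n s' \<and> regs s' 7 = n"
    then have I: "I n s'" by simp
    have "unpaid s' = duo v"
      using I supp_less by (auto simp: I_def unpaid_def duo_def)
    moreover have "loaded s'" using I loaded_agree[OF s, of _ "{11, 12}"] by (auto simp: I_def)
    ultimately show "ready v s'"
      using I zero(1) v invar_init[OF base] by (auto simp: ready_def I_def agree_def)
  qed simp
qed

lemma Run_fill:
  assumes s: "loaded s" and zero: "\<And>c. arrays s 8 c = 0"
  shows "Run fill_com s (n * 3 + 2) (\<lambda>s'. agree {7} {8} s s' \<and>
    arrays s' 8 = (\<lambda>a. if a < n then 3 else 0))"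
proof -
  define I where "I i s' \<longleftrightarrow> agree {7} {8} s s' \<and> arrays s' 8 = (\<lambda>a. if a < i then 3 else 0)" for i s'
  have "Run fill_com s (n * (1 + 2) + 2) (\<lambda>s'. I n s' \<and> regs s' 7 = n)"
    unfolding fill_com_def
  proof (rule Run_For[where I = I])
    show "I 0 (set_reg 7 0 s)" using zero by (simp add: I_def agree_def fun_eq_iff)
  next
    fix i s' assume "I i s'"
    then show "regs s' 2 = n" using s by (simp add: I_def agree_def loaded_def)
  next
    fix i s1 assume "I i s1" "regs s1 7 = i"
    then show "Run (Store 8 (Reg 7) (Const 3)) s1 1
      (\<lambda>s'. regs s' 7 = i \<and> I (Suc i) (set_reg 7 (Suc i) s'))"
      by (intro Run_straight) (auto simp: I_def agree_def fun_eq_iff)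
  qed
  then show ?thesis by (rule Run_mono) (auto simp: I_def)
qed

lemma Run_output:
  assumes s: "loaded s"
  defines "u \<equiv> arrays s 8"
  shows "Run output_com s (n * 10 + 3) (\<lambda>s'. result s' =
    map (\<lambda>a. if a \<in> supp u then Suc (head u a) else 0) [0..<n])"
proof -
  define f where "f a = (if a \<in> supp u then Suc (head u a) else 0)" for a
  define I where "I i s' \<longleftrightarrow> agree {4, 10, 11, 12} {1} s s' \<and> (\<forall>a<i. arrays s' 1 a = f a)" for i s'
  let ?c = "Cond (Equal (Reg 10) (Const 0)) (Store 1 (Reg 4) (Const 0)) (Store 1 (Reg 4) (Add (Reg 11) (Const 1)))"
  have "Run output_com s ((n * (8 + 2) + 2) + 1) (\<lambda>s'. result s' = map f [0..<n])"
    unfolding output_com_def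
  proof (rule Run_Seq)
    show "Run (For 4 2 (Seq (look 8 4) ?c)) s (n * (8 + 2) + 2) (\<lambda>s'. I n s' \<and> regs s' 4 = n)"
    proof (rule Run_For[where I = I])
      show "I 0 (set_reg 4 0 s)" by (simp add: I_def agree_def)
    next
      fix i s' assume "I i s'"
      then show "regs s' 2 = n" using s by (simp add: I_def agree_def loaded_def)
    next
      fix i s1 assume i: "i < n" "I i s1" "regs s1 4 = i"
      have ag1: "agree {4, 10, 11, 12} {1} s s1" using i(2) by (simp add: I_def)
      have l1: "loaded s1" using loaded_agree[OF s ag1] by simp
      have a8: "arrays s1 8 = u" using ag1 by (auto simp: agree_def u_def)
      define s2 where "s2 = ev (look 8 4) s1"
      note lk = ev_look[OF l1 i(3) i(1), of 8, folded s2_def, unfolded a8, simplified]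
      have arr2: "arrays s2 = arrays s1" "regs s2 4 = i" using lk(1) i(3) by (auto simp: agree_def)
      have "0 < rk i (head u i)" if "i \<in> supp u"
        using first_entry[OF head_first[OF that]] rk_pos by (auto simp: entry_def)
      then have ev: "ev (Seq (look 8 4) ?c) s1 = set_cell 1 i (f i) s2"
        using arr2 lk(2,3) by (auto simp: s2_def[symmetric] f_def)
      have "I (Suc i) (set_reg 4 (Suc i) (set_cell 1 i (f i) s2))"
        using i(2) ag1 lk(1) arr2 by (auto simp: I_def agree_def less_Suc_eq)
      then show "Run (Seq (look 8 4) ?c) s1 8 (\<lambda>s'. regs s' 4 = i \<and> I (Suc i) (set_reg 4 (Suc i) s'))"
        using arr2 by (intro Run_straight) (simp_all only: ev, simp_all)
    qed
  next
    fix s' assume "I n s' \<and> regs s' 4 = n"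
    then show "Run (Assign 1 (Reg 2)) s' 1 (\<lambda>s'. result s' = map f [0..<n])"
      using s by (intro Run_straight) (auto simp: I_def result_def loaded_def agree_def)
  qed
  then show ?thesis by (rule Run_mono) (simp_all add: f_def)
qed

lemma Run_ranks:
  assumes s: "regs s 2 = n" "regs s 3 = Suc (3 * n)"
    "\<And>a k. a < n \<Longrightarrow> k \<in> {1, 2, 3} \<Longrightarrow> arrays s (1 + k) a = choice k a"
  shows "Run ranks_com s (n * 14 + 2) (\<lambda>s'. agree {7} {5, 6, 7} s s' \<and> loaded s')"
proof -
  define J where "J s' i k \<longleftrightarrow> (\<forall>b. E i b \<and> rk i b = k \<longrightarrow> arrays s' (4 + k) i = rk b i)"
    for s' :: state and i k
  define I where "I i s' \<longleftrightarrow> agree {7} {5, 6, 7} s s' \<and> (\<forall>a<i. \<forall>k\<in>{1, 2, 3}. J s' a k)" for i s'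
  \<comment> \<open>The witness 0 stands for "nothing stored"; this is unambiguous because ranks are
    positive.\<close>
  have ev_rank: "\<exists>x. ev (rank_com k) s1 = (if x = 0 then s1 else set_cell (4 + k) i x s1) \<and>
      J (ev (rank_com k) s1) i k"
    if k: "k \<in> {1, 2, 3}" and i: "i < n" "regs s1 7 = i" and ag: "agree {7} {5, 6, 7} s s1" for k i s1
  proof -
    have nbs: "arrays s1 (1 + j) a = choice j a" if "a < n" "j \<in> {1, 2, 3}" for j a
      using ag that s(3)[OF that] by (auto simp: agree_def)
    show ?thesis
    proof (cases "choice k i")
      case 0
      then have "ev (rank_com k) s1 = s1" using nbs[OF i(1) k] i by (simp add: rank_com_def)
      moreover have "J s1 i k" using 0 choice_0 by (auto simp: J_def)
      ultimately show ?thesis by (intro exI[of _ 0]) simp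
    next
      case (Suc b)
      have b: "E i b" "rk i b = k" using choice_pos[OF Suc] by auto
      have Eb: "E b i" using E_sym b(1) by blast
      have bn: "b < n" using E_less Eb by blast
      define x where "x = (if choice 1 b = Suc i then 1 else if choice 2 b = Suc i then 2 else 3 :: nat)"
      have ev: "ev (rank_com k) s1 = set_cell (4 + k) i x s1"
        using nbs[OF i(1) k] nbs[OF bn, of 1] nbs[OF bn, of 2] i Suc
        by (simp add: rank_com_def x_def numeral_2_eq_2 numeral_3_eq_3)
      have "rk b i \<in> {1, 2, 3}" using rk_pos[OF Eb] rk_le[OF Eb] by auto
      then have "x = rk b i"
        using choice_eq[OF Eb] choice_pos[of 1 b i] choice_pos[of 2 b i] by (auto simp: x_def)
      moreover have "c = b" if "E i c" "rk i c = k" for c using rk_inj b that by auto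
      ultimately have "J (set_cell (4 + k) i x s1) i k" by (auto simp: J_def)
      moreover have "x \<noteq> 0" by (simp add: x_def)
      ultimately show ?thesis using ev by (intro exI[of _ x]) simp
    qed
  qed
  have "Run ranks_com s (n * (12 + 2) + 2) (\<lambda>s'. I n s' \<and> regs s' 7 = n)"
    unfolding ranks_com_def
  proof (rule Run_For[where I = I])
    show "I 0 (set_reg 7 0 s)" by (simp add: I_def agree_def)
  next
    fix i s' assume "I i s'"
    then show "regs s' 2 = n" using s by (simp add: I_def agree_def)
  next
    fix i s1 assume i: "i < n" "I i s1" "regs s1 7 = i"
    have keep: "regs (ev (rank_com k) s') = regs s' \<and> agree {} {4 + k} s' (ev (rank_com k) s') \<and>
        J (ev (rank_com k) s') i k \<and> (\<forall>a j. a \<noteq> i \<or> j \<noteq> k \<longrightarrow> J (ev (rank_com k) s') a j = J s' a j)"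
      if K: "k \<in> {1, 2, 3}" "regs s' 7 = i" "agree {7} {5, 6, 7} s s'" for k s'
    proof -
      obtain x where x: "ev (rank_com k) s' = (if x = 0 then s' else set_cell (4 + k) i x s')"
        "J (ev (rank_com k) s') i k"
        using ev_rank[OF K(1) i(1) K(2,3)] by blast
      show ?thesis
      proof (cases "x = 0")
        case True
        then show ?thesis using x by (simp add: agree_def)
      next
        case False
        then have e: "ev (rank_com k) s' = set_cell (4 + k) i x s'" using x by simp
        have "J (set_cell (4 + k) i x s') a j = J s' a j" if "a \<noteq> i \<or> j \<noteq> k" for a j
          using that by (auto simp: J_def)
        then show ?thesis using x(2) unfolding e by (simp add: agree_def)
      qed
    qed
    define s2 where "s2 = ev (rank_com 1) s1"
    define s3 where "s3 = ev (rank_com 2) s2"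
    define s4 where "s4 = ev (rank_com 3) s3"
    have ag1: "agree {7} {5, 6, 7} s s1" using i(2) by (simp add: I_def)
    note k1 = keep[of 1 s1, folded s2_def, simplified, OF i(3) ag1]
    have ag2: "agree {7} {5, 6, 7} s s2" using ag1 k1 by (auto simp: agree_def)
    have "regs s2 7 = i" using k1 i(3) by simp
    note k2 = keep[of 2 s2, folded s3_def, simplified, OF this ag2]
    have ag3: "agree {7} {5, 6, 7} s s3" using ag2 k2 by (auto simp: agree_def)
    have "regs s3 7 = i" using k1 k2 i(3) by simp
    note k3 = keep[of 3 s3, folded s4_def, simplified, OF this ag3]
    have ag4: "agree {7} {5, 6, 7} s s4" using ag3 k3 by (auto simp: agree_def)
    have "\<forall>k\<in>{1, 2, 3}. J s4 a k" if "a < Suc i" for a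
    proof (cases "a = i")
      case True
      then show ?thesis using k1 k2 k3 by auto
    next
      case False
      then have "\<forall>k\<in>{1, 2, 3}. J s1 a k" using that i(2) by (simp add: I_def)
      then show ?thesis using False k1 k2 k3 by auto
    qed
    then have "I (Suc i) (set_reg 7 (Suc i) s4)"
      using ag4 by (simp add: I_def agree_def J_def)
    moreover have "regs s4 7 = i" using k1 k2 k3 i(3) by simp
    moreover have ev: "ev (Seq (rank_com 1) (Seq (rank_com 2) (rank_com 3))) s1 = s4"
      by (simp add: s2_def s3_def s4_def)
    ultimately show "Run (Seq (rank_com 1) (Seq (rank_com 2) (rank_com 3))) s1 12
      (\<lambda>s'. regs s' 7 = i \<and> I (Suc i) (set_reg 7 (Suc i) s'))"
      by (intro Run_straight) (simp_all only: ev, simp_all)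
  qed
  then show ?thesis
  proof (rule Run_mono)
    fix s' assume I: "I n s' \<and> regs s' 7 = n"
    then have ag: "agree {7} {5, 6, 7} s s'" by (simp add: I_def)
    have "arrays s' (1 + k) a = choice k a" if "a < n" "k \<in> {1, 2, 3}" for a k
      using ag that s(3)[OF that] by (auto simp: agree_def)
    then have "loaded s'" using I ag s by (auto simp: loaded_def I_def J_def agree_def)
    then show "agree {7} {5, 6, 7} s s' \<and> loaded s'" using ag by blast
  qed simp
qed

end

section \<open>Instances with short lists\<close>

locale short_sri =
  fixes I :: "nat sri"
  assumes sri: "sri_instance I" and numbered: "numbered I"
    and short: "\<And>a. a \<in> agents I \<Longrightarrow> length (pref_list I a) \<le> 3"
begin

abbreviation N :: nat where "N \<equiv> card (agents I)"

abbreviation adj :: "nat \<Rightarrow> nat \<Rightarrow> bool" where "adj a b \<equiv> {a, b} \<in> edges I"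

lemma agents_iff: "a \<in> agents I \<longleftrightarrow> a < N"
  using numbered unfolding numbered_def by (metis atLeastLessThan_iff zero_le)

lemma adjD: "adj a b \<Longrightarrow> a < N \<and> b < N \<and> a \<noteq> b"
  using sri unfolding sri_instance_def agents_iff by (auto simp: doubleton_eq_iff)

lemma pref_distinct: "a < N \<Longrightarrow> distinct (pref_list I a)"
  and set_pref: "a < N \<Longrightarrow> set (pref_list I a) = {b. adj a b}"
  and length_pref: "a < N \<Longrightarrow> length (pref_list I a) \<le> 3"
  using sri short by (auto simp: sri_instance_def agents_iff)

lemma rank_nth:
  assumes "a < N" "i < length (pref_list I a)"
  shows "rank I a (pref_list I a ! i) = Suc i"
proof -
  let ?P = "pref_list I a"
  have "{c. prefers I a c (?P ! i)} = (!) ?P ` {..<i}"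
  proof
    show "{c. prefers I a c (?P ! i)} \<subseteq> (!) ?P ` {..<i}"
      using assms pref_distinct[OF assms(1)] by (auto simp: prefers_def nth_eq_iff_index_eq)
    show "(!) ?P ` {..<i} \<subseteq> {c. prefers I a c (?P ! i)}"
      using assms(2) by (auto simp: prefers_def)
  qed
  moreover have "card ((!) ?P ` {..<i}) = i"
    using assms pref_distinct[OF assms(1)] by (simp add: card_image inj_on_nth)
  ultimately show ?thesis by (simp add: rank_def)
qed

lemma adj_nth:
  assumes "adj a b"
  obtains i where "i < length (pref_list I a)" "b = pref_list I a ! i" "rank I a b = Suc i"
proof -
  have "b \<in> set (pref_list I a)" using assms adjD set_pref by blast
  then obtain i where "i < length (pref_list I a)" "b = pref_list I a ! i"
    by (metis in_set_conv_nth)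
  then show thesis using that rank_nth adjD[OF assms] by blast
qed

sublocale roommates N adj "rank I"
proof
  fix a b c
  show "adj a b \<Longrightarrow> adj b a" by (simp add: insert_commute)
  show "adj a b \<Longrightarrow> a < N" using adjD by blast
  show "adj a b \<Longrightarrow> adj a c \<Longrightarrow> rank I a b = rank I a c \<Longrightarrow> b = c"
    by (metis adj_nth nat.inject)
  show "adj a b \<Longrightarrow> 0 < rank I a b" by (simp add: rank_def)
  show "rank I a b \<le> 3" if E: "adj a b"
  proof -
    obtain i where "i < length (pref_list I a)" "rank I a b = Suc i" using E by (rule adj_nth)
    then show ?thesis using length_pref adjD[OF E] by force
  qed
qed

lemma prefers_iff:
  assumes "adj a b" "adj a c"
  shows "prefers I a b c \<longleftrightarrow> rank I a b < rank I a c"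
proof -
  obtain i where i: "i < length (pref_list I a)" "b = pref_list I a ! i" "rank I a b = Suc i"
    using assms(1) by (rule adj_nth)
  obtain j where j: "j < length (pref_list I a)" "c = pref_list I a ! j" "rank I a c = Suc j"
    using assms(2) by (rule adj_nth)
  show ?thesis
    using i j pref_distinct adjD[OF assms(1)] unfolding prefers_def
    by (auto simp: nth_eq_iff_index_eq)
qed

section \<open>Matchings as edge sets and as partial functions\<close>

definition mate :: "nat set set \<Rightarrow> nat \<Rightarrow> nat option" where
  "mate M a = (if matched M a then Some (partner M a) else None)"

lemma partner_eq:
  assumes M: "matching I M" and e: "{a, b} \<in> M"
  shows "partner M a = b"
proof -
  have "c = b" if c: "{a, c} \<in> M" for c
  proof -
    have "{a, c} = {a, b}"
    proof (rule ccontr)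
      assume ne: "{a, c} \<noteq> {a, b}"
      have "pairwise disjnt M" using M by (simp add: matching_def)
      then have "disjnt {a, c} {a, b}" using c e ne by (rule pairwiseD)
      then show False by simp
    qed
    moreover have "a \<noteq> b" using M e adjD unfolding matching_def by blast
    ultimately show ?thesis by (auto simp: doubleton_eq_iff)
  qed
  then show ?thesis unfolding partner_def using e by blast
qed

lemma matching_edge:
  assumes "matching I M" "e \<in> M"
  obtains a b where "e = {a, b}"
  using assms sri unfolding matching_def sri_instance_def by blast

lemma mate_iff:
  assumes M: "matching I M"
  shows "mate M a = Some b \<longleftrightarrow> {a, b} \<in> M"
proof
  assume "mate M a = Some b"
  then have a: "matched M a" "partner M a = b" by (auto simp: mate_def split: if_splits)
  then obtain e where e: "e \<in> M" "a \<in> e" by (auto simp: matched_def)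
  obtain x y where "e = {x, y}" using M e(1) by (rule matching_edge)
  then obtain c where "{a, c} \<in> M" using e by (auto simp: insert_commute)
  then show "{a, b} \<in> M" using partner_eq[OF M] a(2) by metis
next
  assume e: "{a, b} \<in> M"
  then have "matched M a" by (auto simp: matched_def)
  then show "mate M a = Some b" using partner_eq[OF M e] by (simp add: mate_def)
qed

lemma stable_of_mate:
  assumes "stable_matching I M"
  shows "stable (mate M)"
proof -
  have M: "matching I M" and choice: "\<And>e. \<not> blocks I M e"
    using assms by (auto simp: stable_matching_def)
  have sub: "M \<subseteq> edges I" using M by (simp add: matching_def)
  show ?thesis
    unfolding stable_def
  proof (intro conjI allI impI)
    fix a b assume "mate M a = Some b"
    then have e: "{a, b} \<in> M" by (simp add: mate_iff[OF M])
    show "adj a b" using e sub by blast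
    show "mate M b = Some a" using e by (simp add: mate_iff[OF M] insert_commute)
  next
    fix a b assume E: "adj a b"
    show "satisfied (mate M) a b \<or> satisfied (mate M) b a"
    proof (cases "{a, b} \<in> M")
      case True
      then show ?thesis by (auto simp: satisfied_def mate_iff[OF M, symmetric])
    next
      case False
      then obtain x y where xy: "{a, b} = {x, y}" "matched M x" "\<not> prefers I x y (partner M x)"
        using choice[of "{a, b}"] E unfolding blocks_def by blast
      have p: "mate M x = Some (partner M x)" using xy(2) by (simp add: mate_def)
      then have "adj x (partner M x)" using sub by (auto simp: mate_iff[OF M])
      moreover have "adj x y" using E xy(1) by simp
      ultimately have "satisfied (mate M) x y"
        using xy(3) p prefers_iff by (auto simp: satisfied_def not_less)
      then show ?thesis using xy(1) by (auto simp: doubleton_eq_iff)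
    qed
  qed
qed

lemma stable_of_matching:
  assumes q: "stable q"
  defines "M \<equiv> {{a, b} |a b. q a = Some b}"
  shows "stable_matching I M" "mate M = q"
proof -
  have mem: "{a, b} \<in> M \<longleftrightarrow> q a = Some b" for a b
  proof
    assume "{a, b} \<in> M"
    then obtain c d where cd: "{a, b} = {c, d}" "q c = Some d" unfolding M_def by blast
    then have "(a = c \<and> b = d) \<or> (a = d \<and> b = c)" by (simp add: doubleton_eq_iff)
    then show "q a = Some b" using cd(2) stableD(2)[OF q cd(2)] by blast
  qed (auto simp: M_def)
  have sub: "M \<subseteq> edges I" using stableD(1)[OF q] by (auto simp: M_def)
  have disj: "disjnt e f" if ef: "e \<in> M" "f \<in> M" "e \<noteq> f" for e f
  proof (rule ccontr)
    assume "\<not> disjnt e f"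
    then obtain a where a: "a \<in> e" "a \<in> f" by (auto simp: disjnt_iff)
    have edge: "\<exists>b. g = {a, b}" if "g \<in> M" "a \<in> g" for g
      using that by (auto simp: M_def insert_commute)
    obtain b c where bc: "e = {a, b}" "f = {a, c}"
      using edge[OF ef(1) a(1)] edge[OF ef(2) a(2)] by blast
    then have "q a = Some b" "q a = Some c" using ef(1,2) mem[of a b] mem[of a c] by simp_all
    then show False using bc ef(3) by simp
  qed
  then have M: "matching I M" using sub by (auto simp: matching_def pairwise_def)
  have iff: "mate M a = Some b \<longleftrightarrow> q a = Some b" for a b
    using mate_iff[OF M] mem by simp
  have "mate M a = q a" for a
  proof (cases "q a")
    case None
    then have "mate M a \<noteq> Some b" for b using iff[of a b] by simp
    then show ?thesis using None by (cases "mate M a") auto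
  next
    case (Some b)
    then show ?thesis using iff[of a b] by simp
  qed
  then show mate: "mate M = q" by blast
  have "\<not> blocks I M e" for e
  proof
    assume e: "blocks I M e"
    then have eE: "e \<in> edges I"
      and bl: "\<And>a b. e = {a, b} \<Longrightarrow> \<not> matched M a \<or> prefers I a b (partner M a)"
      by (auto simp: blocks_def)
    have no: "\<not> satisfied q a b" if ab: "e = {a, b}" for a b
    proof
      assume "satisfied q a b"
      then obtain c where c: "q a = Some c" "rank I a c \<le> rank I a b" by (auto simp: satisfied_def)
      then have "mate M a = Some c" using mate by simp
      then have "matched M a" "partner M a = c" by (auto simp: mate_def split: if_splits)
      moreover have "adj a c" "adj a b" using stableD(1)[OF q c(1)] eE ab by auto
      ultimately show False using bl[OF ab] prefers_iff[of a b c] c(2) by simp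
    qed
    obtain a b where ab: "e = {a, b}"
      using eE sri unfolding sri_instance_def by blast
    then have "e = {b, a}" by auto
    then show False using no ab stableD(3)[OF q] eE by blast
  qed
  then show "stable_matching I M" using M by (simp add: stable_matching_def)
qed

text \<open>All stable matchings match exactly the agents of \<open>supp v\<close>, so their costs
  are sums over the same set.\<close>

lemma cost_eq_total:
  assumes M: "stable_matching I M" and base: "base v"
  shows "cost I M = total v (mate M)"
proof -
  have st: "stable (mate M)" using stable_of_mate[OF M] .
  have "dom (mate M) = supp v" using dom_inside[OF st] base st by (auto simp: base_def)
  moreover have "{a. a \<in> agents I \<and> matched M a} = dom (mate M)"
  proof -
    have "a < N" if "matched M a" for a
      using that stableD(1)[OF st, of a] adjD by (auto simp: mate_def)
    then show ?thesis by (auto simp: agents_iff mate_def split: if_splits)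
  qed
  ultimately show ?thesis
    unfolding cost_def total_def by (intro sum.cong) (auto simp: mate_def split: if_splits)
qed

section \<open>The encoded input and the whole program\<close>

text \<open>The position of the length field of agent \<open>i\<close>; the leading 1 skips the
  number of agents.\<close>

definition offset :: "nat \<Rightarrow> nat" where
  "offset i = 1 + (\<Sum>j<i. Suc (length (pref_list I j)))"

lemma encode_nth:
  assumes "i < N" "k \<le> length (pref_list I i)"
  shows "offset i + k < length (encode_instance I)"
    "encode_instance I ! (offset i + k) = (length (pref_list I i) # pref_list I i) ! k"
proof -
  define g where "g a = length (pref_list I a) # pref_list I a" for a
  have len: "length (concat (map g [0..<j])) = (\<Sum>a<j. Suc (length (pref_list I a)))" for j
    by (induction j) (auto simp: g_def)
  have "[0..<N] = [0..<i] @ i # [Suc i..<N]"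
    using assms(1) upt_add_eq_append[of 0 i "N - i"] upt_conv_Cons[of i N] by simp
  then have "encode_instance I = N # concat (map g [0..<i]) @ g i @ concat (map g [Suc i..<N])"
    by (simp add: encode_instance_def g_def[abs_def])
  then show "offset i + k < length (encode_instance I)"
    "encode_instance I ! (offset i + k) = (length (pref_list I i) # pref_list I i) ! k"
    using assms(2) len[of i] by (simp_all add: offset_def nth_append) (simp_all add: g_def)
qed

lemma choice_nth:
  assumes "a < N"
  shows "choice (Suc k) a = (if k < length (pref_list I a) then Suc (pref_list I a ! k) else 0)"
proof (cases "k < length (pref_list I a)")
  case True
  then have "adj a (pref_list I a ! k)" using set_pref[OF assms] nth_mem by blast
  then show ?thesis using choice_eq rank_nth[OF assms True] True by fastforce
next
  case False
  have "rank I a b \<noteq> Suc k" if "adj a b" for b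
    using that False by (metis adj_nth nat.inject)
  then show ?thesis using False choice_0 by simp
qed

lemma ev_put:
  "regs (ev (put_com k) s) = regs s"
  "arrays (ev (put_com k) s) = (if k - 1 < regs s 16 then (arrays s)(1 + k := (arrays s (1 + k))
     (regs s 7 := Suc (arrays s 0 (regs s 13 + k)))) else arrays s)"
  by (simp_all add: put_com_def)

lemma Run_parse:
  "Run parse_com (initial_state (encode_instance I)) (N * 10 + 5) (\<lambda>s'.
    regs s' 2 = N \<and> regs s' 3 = Suc (3 * N) \<and>
    (\<forall>a<N. \<forall>k\<in>{1, 2, 3}. arrays s' (1 + k) a = choice k a) \<and> (\<forall>r\<in>{5..12}. \<forall>c. arrays s' r c = 0))"
proof -
  define s where "s = initial_state (encode_instance I)"
  have inp: "arrays s 0 (offset i + k) = (length (pref_list I i) # pref_list I i) ! k"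
    if "i < N" "k \<le> length (pref_list I i)" for i k
    using encode_nth[OF that] by (simp add: s_def initial_state_def)
  have inp0: "arrays s 0 (offset i) = length (pref_list I i)" if "i < N" for i
    using inp[OF that, of 0] by simp
  have inpS: "arrays s 0 (offset i + Suc k) = pref_list I i ! k"
    if "i < N" "k < length (pref_list I i)" for i k
    using inp[OF that(1), of "Suc k"] that(2) by simp
  have r2: "arrays s 0 0 = N" by (simp add: s_def initial_state_def encode_instance_def)
  have zero: "arrays s r c = 0" if "r \<noteq> 0" for r c
    using that by (simp add: s_def initial_state_def)
  define J where "J i s' \<longleftrightarrow> regs s' 2 = N \<and> regs s' 3 = Suc (3 * N) \<and> regs s' 13 = offset i \<and>
    arrays s' 0 = arrays s 0 \<and> (\<forall>r\<in>{5..12}. \<forall>c. arrays s' r c = 0) \<and>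
    (\<forall>k\<in>{1, 2, 3}. \<forall>a. arrays s' (1 + k) a = (if a < i then choice k a else 0))"
    for i and s' :: state
  let ?init = "Seq (Assign 2 (Cell 0 (Const 0)))
     (Seq (Assign 3 (Add (Add (Reg 2) (Reg 2)) (Add (Reg 2) (Const 1)))) (Assign 13 (Const 1)))"
  let ?body = "Seq (Assign 16 (Cell 0 (Reg 13))) (Seq (put_com 1) (Seq (put_com 2) (Seq (put_com 3)
       (Assign 13 (Add (Reg 13) (Add (Reg 16) (Const 1)))))))"
  have "Run parse_com s (3 + (N * (8 + 2) + 2)) (\<lambda>s'. J N s' \<and> regs s' 7 = N)"
    unfolding parse_com_def
  proof (rule Run_Seq)
    show "Run ?init s 3 (\<lambda>s'. s' = ev ?init s)" by (rule Run_straight) auto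
  next
    fix s0 assume s0: "s0 = ev ?init s"
    show "Run (For 7 2 ?body) s0 (N * (8 + 2) + 2) (\<lambda>s'. J N s' \<and> regs s' 7 = N)"
    proof (rule Run_For[where I = J])
      show "J 0 (set_reg 7 0 s0)"
        using r2 zero by (auto simp: J_def s0 offset_def)
    next
      fix i s' assume "J i s'"
      then show "regs s' 2 = N" by (simp add: J_def)
    next
      fix i s1 assume i: "i < N" "J i s1" "regs s1 7 = i"
      define L where "L = length (pref_list I i)"
      have L: "arrays s1 0 (regs s1 13) = L" using i inp0 by (simp add: J_def L_def)
      have cell: "arrays s1 0 (regs s1 13 + Suc k) = pref_list I i ! k" if "k < L" for k
        using i(2) inpS[OF i(1), of k] that by (simp add: J_def L_def)
      \<comment> \<open>Missing choices are never written, so their code 0 is the initial content of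
        the cell.\<close>
      have old: "arrays s1 (1 + k) i = 0" if "k \<in> {1, 2, 3}" for k
        using i(2) that by (auto simp: J_def)
      have nbk: "choice (Suc k) i = (if k < L then Suc (pref_list I i ! k) else 0)" for k
        using choice_nth[OF i(1)] by (simp add: L_def)
      define s2 where "s2 = ev ?body s1"
      have rg: "regs s2 = (regs s1)(16 := L, 13 := regs s1 13 + L + 1)"
        by (simp add: s2_def ev_put L fun_upd_twist)
      have ar: "arrays s2 r = arrays s1 r" if "r \<notin> {2, 3, 4}" for r
        using that by (simp add: s2_def ev_put)
      have new: "arrays s2 2 = (arrays s1 2)(i := choice 1 i)" "arrays s2 3 = (arrays s1 3)(i := choice 2 i)"
        "arrays s2 4 = (arrays s1 4)(i := choice 3 i)"
        using nbk[of 0] nbk[of 1] nbk[of 2] cell[of 0] cell[of 1] cell[of 2] old[of 1] old[of 2] old[of 3] i(3) L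
        by (auto simp: s2_def ev_put fun_eq_iff numeral_2_eq_2 numeral_3_eq_3 numeral_eq_Suc)
      have "J (Suc i) (set_reg 7 (Suc i) s2)"
        using i(2) rg ar new unfolding J_def
        by (auto simp: offset_def L_def less_Suc_eq numeral_2_eq_2[symmetric])
      moreover have "regs s2 7 = i" using rg i(3) by simp
      ultimately show "Run ?body s1 8 (\<lambda>s'. regs s' 7 = i \<and> J (Suc i) (set_reg 7 (Suc i) s'))"
        by (intro Run_straight) (simp_all only: s2_def[symmetric], simp_all add: put_com_def)
    qed
  qed
  then show ?thesis unfolding s_def by (rule Run_mono) (auto simp: J_def)
qed

lemma Run_roommates:
  assumes solv: "solvable I"
  obtains M' where "Run roommates_com (initial_state (encode_instance I)) (1000 * (N + 1) ^ 3)
      (\<lambda>s'. result s' = encode_matching I M')"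
    "stable_matching I M'" "\<And>M. stable_matching I M \<Longrightarrow> 7 * cost I M' \<le> 9 * cost I M"
proof -
  obtain M0 where M0: "stable_matching I M0" using solv by (auto simp: solvable_def)
  note solv0 = stable_of_mate[OF M0]
  \<comment> \<open>The value 0 beyond \<open>N\<close> matches the untouched memory cells.\<close>
  define w where "w = (\<lambda>a. if a < N then 3 else 0 :: nat)"
  define v where "v = reduce w"
  have base: "base v" unfolding v_def by (rule base_reduce) (simp add: w_def)
  have v3: "v c \<le> 3" if "c < N" for c
    using reduce_le[of w c] that by (simp add: v_def w_def)
  have v0: "v c = 0" if "N \<le> c" for c
    using reduce_outside[OF that, of w] that by (simp add: v_def w_def)
  define ans where "ans s' M' \<longleftrightarrow> result s' = encode_matching I M' \<and> stable_matching I M' \<and>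
    (\<forall>M. stable_matching I M \<longrightarrow> 7 * cost I M' \<le> 9 * cost I M)" for s' :: state and M'
  have out: "\<exists>M'. ans s' M'"
    if u: "ready v s" "\<forall>a\<in>supp v. gap (arrays s 8) a = 0" and
       res: "result s' = map (\<lambda>a. if a \<in> supp (arrays s 8) then Suc (head (arrays s 8) a) else 0) [0..<N]"
    for s s'
  proof -
    define q where "q a = (if a \<in> supp (arrays s 8) then Some (head (arrays s 8) a) else None)" for a
    have inv: "invar v (arrays s 8) (unpaid s)" using u by (simp add: ready_def)
    then have "supp (arrays s 8) = supp v" by (simp add: invar_def good_def)
    then have gap: "gap (arrays s 8) a = 0" if "a \<in> supp (arrays s 8)" for a using u(2) that by simp
    note apx = invar_approx[OF base v3 inv gap, folded q_def[abs_def]]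
    have q: "stable q" using apx(1)[OF _ _ solv0] by simp
    define M' where "M' = {{a, b} |a b. q a = Some b}"
    have M': "stable_matching I M'" "mate M' = q" using stable_of_matching[OF q] by (simp_all add: M'_def)
    have "matched M' a = (a \<in> supp (arrays s 8))"
      "a \<in> supp (arrays s 8) \<Longrightarrow> partner M' a = head (arrays s 8) a" for a
      using fun_cong[OF M'(2), of a] by (auto simp: mate_def q_def split: if_splits)
    then have "result s' = encode_matching I M'"
      unfolding res encode_matching_def by (intro map_cong) auto
    moreover have "7 * cost I M' \<le> 9 * cost I M" if "stable_matching I M" for M
      using apx(2)[OF _ _ stable_of_mate[OF that]] cost_eq_total[OF _ base] M' that by simp
    ultimately show ?thesis using M'(1) unfolding ans_def by blast
  qed
  let ?t = "7 + 150 * (N + 1) ^ 2"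
  have "Run roommates_com (initial_state (encode_instance I)) ((N * 10 + 5) + ((N * 14 + 2) + ((N * 3 + 2) +
     ((Suc (3 * N) * (N * 10 + 4) + 2) + ((N * 11 + 2) + ((N * (2 * ?t + 2) + 2) + (N * 10 + 3)))))))
     (\<lambda>s'. \<exists>M'. ans s' M')"
    unfolding roommates_com_def
  proof (rule Run_Seq[OF Run_parse])
    fix s1 :: state assume s1: "regs s1 2 = N \<and> regs s1 3 = Suc (3 * N) \<and>
      (\<forall>a<N. \<forall>k\<in>{1, 2, 3}. arrays s1 (1 + k) a = choice k a) \<and> (\<forall>r\<in>{5..12}. \<forall>c. arrays s1 r c = 0)"
    have z1: "arrays s1 r c = 0" if "5 \<le> r" "r \<le> 12" for r c using s1 that by simp
    show "Run (Seq ranks_com (Seq fill_com (Seq (reduce_com 8) (Seq classify_com (Seq main_com output_com))))) s1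
       ((N * 14 + 2) + ((N * 3 + 2) + ((Suc (3 * N) * (N * 10 + 4) + 2) +
         ((N * 11 + 2) + ((N * (2 * ?t + 2) + 2) + (N * 10 + 3)))))) (\<lambda>s'. \<exists>M'. ans s' M')"
    proof (rule Run_Seq[OF Run_ranks])
      fix s2 assume s2: "agree {7} {5, 6, 7} s1 s2 \<and> loaded s2"
      have z2: "arrays s2 r c = 0" if "8 \<le> r" "r \<le> 12" for r c
        using s2 z1 that by (auto simp: agree_def)
      show "Run (Seq fill_com (Seq (reduce_com 8) (Seq classify_com (Seq main_com output_com)))) s2
        ((N * 3 + 2) + ((Suc (3 * N) * (N * 10 + 4) + 2) +
         ((N * 11 + 2) + ((N * (2 * ?t + 2) + 2) + (N * 10 + 3))))) (\<lambda>s'. \<exists>M'. ans s' M')"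
      proof (rule Run_Seq[OF Run_fill])
        fix s3 assume s3: "agree {7} {8} s2 s3 \<and> arrays s3 8 = (\<lambda>a. if a < N then 3 else 0)"
        have l3: "loaded s3" using s2 s3 loaded_agree[of s2 "{7}" "{8}" s3] by simp
        have z3: "arrays s3 r c = 0" if "9 \<le> r" "r \<le> 12" for r c
          using s3 z2 that by (auto simp: agree_def)
        show "Run (Seq (reduce_com 8) (Seq classify_com (Seq main_com output_com))) s3
          ((Suc (3 * N) * (N * 10 + 4) + 2) +
           ((N * 11 + 2) + ((N * (2 * ?t + 2) + 2) + (N * 10 + 3)))) (\<lambda>s'. \<exists>M'. ans s' M')"
        proof (rule Run_Seq[OF Run_reduce[OF l3]])
          fix s4 assume s4: "agree {5, 6, 10, 11, 12} {8} s3 s4 \<and> arrays s4 8 = reduce (arrays s3 8)"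
          have l4: "loaded s4" using s4 loaded_agree[OF l3, of "{5, 6, 10, 11, 12}" "{8}" s4] by simp
          have a8: "arrays s4 8 = v" using s3 s4 by (simp add: v_def w_def)
          have z4: "arrays s4 r c = 0" if "9 \<le> r" "r \<le> 12" for r c
            using s4 z3 that by (auto simp: agree_def)
          show "Run (Seq classify_com (Seq main_com output_com)) s4
            ((N * 11 + 2) + ((N * (2 * ?t + 2) + 2) + (N * 10 + 3))) (\<lambda>s'. \<exists>M'. ans s' M')"
          proof (rule Run_Seq[OF Run_classify[OF l4 base a8]])
            fix s5 assume s5: "ready v s5"
            show "Run (Seq main_com output_com) s5 ((N * (2 * ?t + 2) + 2) + (N * 10 + 3)) (\<lambda>s'. \<exists>M'. ans s' M')"
            proof (rule Run_Seq[OF Run_main[OF s5 base v3 solv0]])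
              fix s6 assume s6: "ready v s6 \<and> (\<forall>a\<in>supp v. gap (arrays s6 8) a = 0)"
              have "loaded s6" using s6 by (simp add: ready_def)
              then show "Run output_com s6 (N * 10 + 3) (\<lambda>s'. \<exists>M'. ans s' M')"
                using s6 out by (intro Run_mono[OF Run_output]) auto
            qed
          qed (use z4 v0 a8 in auto)
        qed simp
      qed (use s2 z2 in auto)
    qed (use s1 in auto)
  qed
  \<comment> \<open>The main loop dominates: at most \<open>2 N\<close> branchings of at most
    \<open>150 (N + 1)^2\<close> steps each.\<close>
  then have "Run roommates_com (initial_state (encode_instance I)) (1000 * (N + 1) ^ 3) (\<lambda>s'. \<exists>M'. ans s' M')"
    by (rule Run_mono) (auto simp: power2_eq_square power3_eq_cube algebra_simps)
  then obtain t s' M' where "exec roommates_com (initial_state (encode_instance I)) t s'"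
    "t \<le> 1000 * (N + 1) ^ 3" "ans s' M'" unfolding Run_def by blast
  then show thesis
    using that[of M'] unfolding Run_def ans_def by blast
qed

end

lemma length_le_bit_size: "length xs \<le> bit_size xs"
  by (induction xs) (auto simp: bit_size_def)

text \<open>Even an empty list contributes its length field, and the number of agents comes on
  top.\<close>

lemma length_encode_instance: "card (agents I) < length (encode_instance I)"
proof -
  have "length xs \<le> length (concat (map (\<lambda>a. length (pref_list I a) # pref_list I a) xs))" for xs
    by (induction xs) auto
  from this[of "[0..<card (agents I)]"] show ?thesis by (simp add: encode_instance_def)
qed

theorem theorem2:
  shows "\<exists>(alg :: com) (p :: nat poly). \<forall>I :: nat sri.
    sri_instance I \<and> numbered I \<and> solvable I \<and>
    (\<forall>a \<in> agents I. length (pref_list I a) \<le> 3) \<longrightarrow>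
    (\<exists>t M'. computes alg (encode_instance I) t (encode_matching I M') \<and>
       t \<le> poly p (bit_size (encode_instance I)) \<and>
       stable_matching I M' \<and>
       (\<forall>M_egal. egalitarian I M_egal \<longrightarrow> real (cost I M') \<le> 9 / 7 * real (cost I M_egal)))"
proof (rule exI[of _ roommates_com], rule exI[of _ "monom 1000 3"], intro allI impI)
  fix I :: "nat sri"
  assume *: "sri_instance I \<and> numbered I \<and> solvable I \<and>
    (\<forall>a \<in> agents I. length (pref_list I a) \<le> 3)"
  then interpret short_sri I by unfold_locales auto
  obtain M' where M': "Run roommates_com (initial_state (encode_instance I)) (1000 * (N + 1) ^ 3)
      (\<lambda>s'. result s' = encode_matching I M')"
    "stable_matching I M'" "\<And>M. stable_matching I M \<Longrightarrow> 7 * cost I M' \<le> 9 * cost I M"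
    using Run_roommates * by blast
  obtain t s' where t: "exec roommates_com (initial_state (encode_instance I)) t s'"
    "t \<le> 1000 * (N + 1) ^ 3" "result s' = encode_matching I M'"
    using M'(1) unfolding Run_def by blast
  \<comment> \<open>Time was bounded in the number of agents; this converts the bound to the size of
    the input.\<close>
  have "N + 1 \<le> bit_size (encode_instance I)"
    using length_encode_instance[of I] length_le_bit_size[of "encode_instance I"] by linarith
  then have "1000 * (N + 1) ^ 3 \<le> poly (monom 1000 3) (bit_size (encode_instance I))"
    by (simp only: poly_monom) (intro mult_le_mono2 power_mono, simp_all)
  moreover have "real (cost I M') \<le> 9 / 7 * real (cost I M)" if "egalitarian I M" for M
  proof -
    have "7 * cost I M' \<le> 9 * cost I M"
      using that M'(3) by (simp add: egalitarian_def is_arg_min_def)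
    then show ?thesis by linarith
  qed
  ultimately show "\<exists>t M'. computes roommates_com (encode_instance I) t (encode_matching I M') \<and>
       t \<le> poly (monom 1000 3) (bit_size (encode_instance I)) \<and>
       stable_matching I M' \<and>
       (\<forall>M_egal. egalitarian I M_egal \<longrightarrow> real (cost I M') \<le> 9 / 7 * real (cost I M_egal))"
    using t M'(2) unfolding computes_def by (meson order_trans)
qed

end
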